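(* Let $L,H$ be causal models (in a Markov category) such that $V_H^{\rm nin}\subseteq V_H^{\rm out}$, with signatures $\Sigma_L,\Sigma_H$, and let $\mathbf S_L,\mathbf S_H$ be the free Markov categories on $\Sigma_L,\Sigma_H$. A cd-functor $\pi_S\colon\mathbf S_H\to\mathbf S_L$ is structurally well-behaved if and only if $\pi_S(D_H)$ is again a network diagram in $\mathbf S_L$, where $D_H\colon V_H^{\rm in}\to V_H^{\rm out}$ is the network diagram of $H$, and $\pi_S(V_H^{\rm in})=V_L^{\rm in}$, $\pi_S(V_H^{\rm out})\subseteq V_L^{\rm out}$ and $\pi_S(V_H^{\rm nin})\subseteq V_L^{\rm nin}$.
   Context: **Categories.** A Markov category is a symmetric monoidal category with terminal unit $I$ in which each object has a commutative comonoid structure (copy $A\to A\otimes A$, discard $A\to I$) compatible with $\otimes$. A cd-functor is a strong symmetric monoidal functor preserving copy and discard. **Causal models.** An open DAG is a finite DAG $G$ with vertex set $V$ (variables) and a subset $V^{\rm in}\subseteq V$ of parentless vertices (inputs); $V^{\rm nin}=V\setminus V^{\rm in}$. Its signature $\Sigma$ has an object $X$ for each vertex and a generator $c_X\colon\mathrm{Pa}(X)\to X$ for each $X\in V^{\rm nin}$. A causal model of $G$ in a Markov category $\mathcal C$ is an assignment of objects of $\mathcal C$ to variables and morphisms of $\mathcal C$ to the generators $c_X$ of the corresponding types, with a specified subset $V^{\rm out}\subseteq V$ of outputs. $G_L$, $G_H$ denote the DAGs of $L$, $H$. **Free Markov category.** The objects of the free Markov category on $\Sigma$ are finite lists of variables;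 morphisms are string diagrams built from the generators $c_X$, copies and discards, modulo the Markov category axioms (in particular $\mathrm{disc}\circ c_X=\mathrm{disc}$). A condition such as $\pi_S(S)\subseteq T$, for sets of variables $S,T$, means that the list obtained by concatenating the lists $\pi_S(X)$, $X\in S$, has no repetitions and its entries lie in $T$; $\pi_S(S)=T$ means that moreover every element of $T$ occurs (order is ignored). **Network diagrams.** A network diagram is a string diagram built from single-output boxes, copies and discards with labelled wires such that wires not connected by copy maps have distinct labels, and each label appears at most once as an output of the diagram and at most once as an input to any given box. It is normalised if every non-input variable in it has a path to an output. The network diagram $D_H\colon V_H^{\rm in}\to V_H^{\rm out}$ wires together, with copy maps, one box $c_X$ for each non-input variable $X$ with a directed path (possibly of length 0) to $V_H^{\rm out}$, copies each output variable once more to form an output, and discards inputs with no path to the outputs. **Well-behavedness (Markov type).** For a family $(\pi(X))_{X\in V_H}$ of disjoint subsets of $V_L$, let $\mathsf M(X)$ be the set of $Z\in V_L$ for which there is a directed path (possibly of length 0) in $G_L$ from $Z$ to an element of $\pi(X)$ not passing through $\pi(\mathrm{Pa}(X))=\bigcup_{Y\in\mathrm{Pa}(X)}\pi(Y)$. A cd-functor $\pi_S\colon\mathbf S_H\to\mathbf S_L$ is *structurally well-behaved* if each $\pi_S(c_X)$, $X\in V_H^{\rm nin}$, is a normalised network diagram in $\mathbf S_L$; the $\pi(X):=\pi_S(X)$, $X\in V_H$, are pairwise disjoint subsets of $V_L$ with $\pi(V_H^{\rm in})=V_L^{\rm in}$ and $\pi(V_H^{\rm out})\subseteq V_L^{\rm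 out}$; and $\mathsf M(X)\cap\mathsf M(Y)=\emptyset$ for all $X\ne Y$ in $V_H$. *)

theory Defs
  imports Main
begin

section \<open>Markov categories and cd-functors\<close>

record ('o, 'a) markov_data =
  Obj :: "'o set"
  Arr :: "'a set"
  Dom :: "'a \<Rightarrow> 'o"
  Cod :: "'a \<Rightarrow> 'o"
  Ide :: "'o \<Rightarrow> 'a"
  Cmp :: "'a \<Rightarrow> 'a \<Rightarrow> 'a"    (infixl "\<Zsemi>\<index>" 55)
  TenO :: "'o \<Rightarrow> 'o \<Rightarrow> 'o"    (infixr "\<odot>\<index>" 70)
  TenA :: "'a \<Rightarrow> 'a \<Rightarrow> 'a"    (infixr "\<otimes>\<index>" 70)
  Unt :: "'o"
  Assoc :: "'o \<Rightarrow> 'o \<Rightarrow> 'o \<Rightarrow> 'a"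
  LUnit :: "'o \<Rightarrow> 'a"
  RUnit :: "'o \<Rightarrow> 'a"
  Sym :: "'o \<Rightarrow> 'o \<Rightarrow> 'a"
  Copy :: "'o \<Rightarrow> 'a"
  Disc :: "'o \<Rightarrow> 'a"

definition Hom :: "('o, 'a, 'z) markov_data_scheme \<Rightarrow> 'o \<Rightarrow> 'o \<Rightarrow> 'a set" where
  "Hom C A B = {f \<in> Arr C. Dom C f = A \<and> Cod C f = B}"

text \<open>Composition \<open>f \<Zsemi> g\<close> is in diagrammatic order: first \<open>f\<close>, then \<open>g\<close>.\<close>

locale category =
  fixes C :: "('o, 'a, 'z) markov_data_scheme" (structure)
  assumes Dom_Obj: "f \<in> Arr C \<Longrightarrow> Dom C f \<in> Obj C"
    and Cod_Obj: "f \<in> Arr C \<Longrightarrow> Cod C f \<in> Obj C"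
    and Ide_Hom: "A \<in> Obj C \<Longrightarrow> Ide C A \<in> Hom C A A"
    and Cmp_Hom: "\<lbrakk>f \<in> Hom C A B; g \<in> Hom C B D\<rbrakk> \<Longrightarrow> f \<Zsemi> g \<in> Hom C A D"
    and Ide_left: "f \<in> Hom C A B \<Longrightarrow> Ide C A \<Zsemi> f = f"
    and Ide_right: "f \<in> Hom C A B \<Longrightarrow> f \<Zsemi> Ide C B = f"
    and Cmp_assoc: "\<lbrakk>f \<in> Hom C A B; g \<in> Hom C B D; h \<in> Hom C D E\<rbrakk>
          \<Longrightarrow> (f \<Zsemi> g) \<Zsemi> h = f \<Zsemi> (g \<Zsemi> h)"

definition inverse_arrs :: "('o, 'a, 'z) markov_data_scheme \<Rightarrow> 'a \<Rightarrow> 'a \<Rightarrow> bool" where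
  "inverse_arrs C f g \<longleftrightarrow> f \<in> Arr C \<and> g \<in> Hom C (Cod C f) (Dom C f) \<and>
     f \<Zsemi>\<^bsub>C\<^esub> g = Ide C (Dom C f) \<and> g \<Zsemi>\<^bsub>C\<^esub> f = Ide C (Cod C f)"

definition iso_arr :: "('o, 'a, 'z) markov_data_scheme \<Rightarrow> 'a \<Rightarrow> bool" where
  "iso_arr C f \<longleftrightarrow> (\<exists>g. inverse_arrs C f g)"

definition Inv :: "('o, 'a, 'z) markov_data_scheme \<Rightarrow> 'a \<Rightarrow> 'a" where
  "Inv C f = (THE g. inverse_arrs C f g)"

locale symmetric_monoidal_category = category +
  assumes Unt_Obj: "Unt C \<in> Obj C"
    and TenO_Obj: "\<lbrakk>A \<in> Obj C; B \<in> Obj C\<rbrakk> \<Longrightarrow> A \<odot> B \<in> Obj C"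
    and TenA_Hom: "\<lbrakk>f \<in> Hom C A B; g \<in> Hom C A' B'\<rbrakk> \<Longrightarrow> f \<otimes> g \<in> Hom C (A \<odot> A') (B \<odot> B')"
    and TenA_Ide: "\<lbrakk>A \<in> Obj C; B \<in> Obj C\<rbrakk> \<Longrightarrow> Ide C A \<otimes> Ide C B = Ide C (A \<odot> B)"
    and TenA_Cmp: "\<lbrakk>f \<in> Hom C A B; g \<in> Hom C B D; f' \<in> Hom C A' B'; g' \<in> Hom C B' D'\<rbrakk>
          \<Longrightarrow> (f \<Zsemi> g) \<otimes> (f' \<Zsemi> g') = (f \<otimes> f') \<Zsemi> (g \<otimes> g')"
    and Assoc_Hom: "\<lbrakk>A \<in> Obj C; B \<in> Obj C; D \<in> Obj C\<rbrakk>
          \<Longrightarrow> Assoc C A B D \<in> Hom C ((A \<odot> B) \<odot> D) (A \<odot> (B \<odot> D))"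
    and Assoc_iso: "\<lbrakk>A \<in> Obj C; B \<in> Obj C; D \<in> Obj C\<rbrakk> \<Longrightarrow> iso_arr C (Assoc C A B D)"
    and Assoc_natural: "\<lbrakk>f \<in> Hom C A A'; g \<in> Hom C B B'; h \<in> Hom C D D'\<rbrakk>
          \<Longrightarrow> ((f \<otimes> g) \<otimes> h) \<Zsemi> Assoc C A' B' D' = Assoc C A B D \<Zsemi> (f \<otimes> (g \<otimes> h))"
    and LUnit_Hom: "A \<in> Obj C \<Longrightarrow> LUnit C A \<in> Hom C (Unt C \<odot> A) A"
    and LUnit_iso: "A \<in> Obj C \<Longrightarrow> iso_arr C (LUnit C A)"
    and LUnit_natural: "f \<in> Hom C A B \<Longrightarrow> (Ide C (Unt C) \<otimes> f) \<Zsemi> LUnit C B = LUnit C A \<Zsemi> f"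
    and RUnit_Hom: "A \<in> Obj C \<Longrightarrow> RUnit C A \<in> Hom C (A \<odot> Unt C) A"
    and RUnit_iso: "A \<in> Obj C \<Longrightarrow> iso_arr C (RUnit C A)"
    and RUnit_natural: "f \<in> Hom C A B \<Longrightarrow> (f \<otimes> Ide C (Unt C)) \<Zsemi> RUnit C B = RUnit C A \<Zsemi> f"
    and pentagon: "\<lbrakk>A \<in> Obj C; B \<in> Obj C; D \<in> Obj C; E \<in> Obj C\<rbrakk>
          \<Longrightarrow> Assoc C (A \<odot> B) D E \<Zsemi> Assoc C A B (D \<odot> E)
            = (Assoc C A B D \<otimes> Ide C E) \<Zsemi> Assoc C A (B \<odot> D) E \<Zsemi> (Ide C A \<otimes> Assoc C B D E)"
    and triangle: "\<lbrakk>A \<in> Obj C; B \<in> Obj C\<rbrakk>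
          \<Longrightarrow> Assoc C A (Unt C) B \<Zsemi> (Ide C A \<otimes> LUnit C B) = RUnit C A \<otimes> Ide C B"
    and Sym_Hom: "\<lbrakk>A \<in> Obj C; B \<in> Obj C\<rbrakk> \<Longrightarrow> Sym C A B \<in> Hom C (A \<odot> B) (B \<odot> A)"
    and Sym_natural: "\<lbrakk>f \<in> Hom C A A'; g \<in> Hom C B B'\<rbrakk>
          \<Longrightarrow> (f \<otimes> g) \<Zsemi> Sym C A' B' = Sym C A B \<Zsemi> (g \<otimes> f)"
    and Sym_Sym: "\<lbrakk>A \<in> Obj C; B \<in> Obj C\<rbrakk> \<Longrightarrow> Sym C A B \<Zsemi> Sym C B A = Ide C (A \<odot> B)"
    and hexagon: "\<lbrakk>A \<in> Obj C; B \<in> Obj C; D \<in> Obj C\<rbrakk>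
          \<Longrightarrow> Assoc C A B D \<Zsemi> Sym C A (B \<odot> D) \<Zsemi> Assoc C B D A
            = (Sym C A B \<otimes> Ide C D) \<Zsemi> Assoc C B A D \<Zsemi> (Ide C B \<otimes> Sym C A D)"

text \<open>The canonical isomorphism \<open>(A \<odot> A) \<odot> (B \<odot> B) \<rightarrow> (A \<odot> B) \<odot> (A \<odot> B)\<close>.\<close>

definition mid_swap :: "('o, 'a, 'z) markov_data_scheme \<Rightarrow> 'o \<Rightarrow> 'o \<Rightarrow> 'a" where
  "mid_swap C A B =
     Assoc C A A (B \<odot>\<^bsub>C\<^esub> B) \<Zsemi>\<^bsub>C\<^esub>
     (Ide C A \<otimes>\<^bsub>C\<^esub>
        (Inv C (Assoc C A B B) \<Zsemi>\<^bsub>C\<^esub> (Sym C A B \<otimes>\<^bsub>C\<^esub> Ide C B) \<Zsemi>\<^bsub>C\<^esub> Assoc C B A B)) \<Zsemi>\<^bsub>C\<^esub>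
     Inv C (Assoc C A B (A \<odot>\<^bsub>C\<^esub> B))"

locale markov_category = symmetric_monoidal_category +
  assumes Copy_Hom: "A \<in> Obj C \<Longrightarrow> Copy C A \<in> Hom C A (A \<odot> A)"
    and Disc_Hom: "A \<in> Obj C \<Longrightarrow> Disc C A \<in> Hom C A (Unt C)"
    and Copy_coassoc: "A \<in> Obj C \<Longrightarrow>
          Copy C A \<Zsemi> (Copy C A \<otimes> Ide C A) \<Zsemi> Assoc C A A A = Copy C A \<Zsemi> (Ide C A \<otimes> Copy C A)"
    and Copy_left_counit: "A \<in> Obj C \<Longrightarrow> Copy C A \<Zsemi> (Disc C A \<otimes> Ide C A) \<Zsemi> LUnit C A = Ide C A"
    and Copy_right_counit: "A \<in> Obj C \<Longrightarrow> Copy C A \<Zsemi> (Ide C A \<otimes> Disc C A) \<Zsemi> RUnit C A = Ide C A"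
    and Copy_comm: "A \<in> Obj C \<Longrightarrow> Copy C A \<Zsemi> Sym C A A = Copy C A"
    and Copy_TenO: "\<lbrakk>A \<in> Obj C; B \<in> Obj C\<rbrakk>
          \<Longrightarrow> Copy C (A \<odot> B) = (Copy C A \<otimes> Copy C B) \<Zsemi> mid_swap C A B"
    and Disc_TenO: "\<lbrakk>A \<in> Obj C; B \<in> Obj C\<rbrakk>
          \<Longrightarrow> Disc C (A \<odot> B) = (Disc C A \<otimes> Disc C B) \<Zsemi> LUnit C (Unt C)"
    and Copy_Unt: "Copy C (Unt C) \<Zsemi> LUnit C (Unt C) = Ide C (Unt C)"
    and Disc_Unt: "Disc C (Unt C) = Ide C (Unt C)"
    and Unt_terminal: "f \<in> Hom C A (Unt C) \<Longrightarrow> f = Disc C A"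

record ('o, 'a, 'p, 'b) monoidal_functor =
  FObj :: "'o \<Rightarrow> 'p"
  FArr :: "'a \<Rightarrow> 'b"
  Mu :: "'o \<Rightarrow> 'o \<Rightarrow> 'b"
  Eps :: "'b"

locale cd_functor = C: markov_category C + D: markov_category D
  for C :: "('o, 'a, 'y) markov_data_scheme" and D :: "('p, 'b, 'z) markov_data_scheme" +
  fixes F :: "('o, 'a, 'p, 'b) monoidal_functor"
  assumes FObj_Obj: "A \<in> Obj C \<Longrightarrow> FObj F A \<in> Obj D"
    and FArr_Hom: "f \<in> Hom C A B \<Longrightarrow> FArr F f \<in> Hom D (FObj F A) (FObj F B)"
    and FArr_Ide: "A \<in> Obj C \<Longrightarrow> FArr F (Ide C A) = Ide D (FObj F A)"
    and FArr_Cmp: "\<lbrakk>f \<in> Hom C A B; g \<in> Hom C B E\<rbrakk>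
          \<Longrightarrow> FArr F (f \<Zsemi>\<^bsub>C\<^esub> g) = FArr F f \<Zsemi>\<^bsub>D\<^esub> FArr F g"
    and Mu_Hom: "\<lbrakk>A \<in> Obj C; B \<in> Obj C\<rbrakk>
          \<Longrightarrow> Mu F A B \<in> Hom D (FObj F A \<odot>\<^bsub>D\<^esub> FObj F B) (FObj F (A \<odot>\<^bsub>C\<^esub> B))"
    and Mu_iso: "\<lbrakk>A \<in> Obj C; B \<in> Obj C\<rbrakk> \<Longrightarrow> iso_arr D (Mu F A B)"
    and Mu_natural: "\<lbrakk>f \<in> Hom C A A'; g \<in> Hom C B B'\<rbrakk>
          \<Longrightarrow> (FArr F f \<otimes>\<^bsub>D\<^esub> FArr F g) \<Zsemi>\<^bsub>D\<^esub> Mu F A' B' = Mu F A B \<Zsemi>\<^bsub>D\<^esub> FArr F (f \<otimes>\<^bsub>C\<^esub> g)"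
    and Eps_Hom: "Eps F \<in> Hom D (Unt D) (FObj F (Unt C))"
    and Eps_iso: "iso_arr D (Eps F)"
    and Mu_Assoc: "\<lbrakk>A \<in> Obj C; B \<in> Obj C; E \<in> Obj C\<rbrakk>
          \<Longrightarrow> (Mu F A B \<otimes>\<^bsub>D\<^esub> Ide D (FObj F E)) \<Zsemi>\<^bsub>D\<^esub> Mu F (A \<odot>\<^bsub>C\<^esub> B) E \<Zsemi>\<^bsub>D\<^esub> FArr F (Assoc C A B E)
            = Assoc D (FObj F A) (FObj F B) (FObj F E) \<Zsemi>\<^bsub>D\<^esub>
              (Ide D (FObj F A) \<otimes>\<^bsub>D\<^esub> Mu F B E) \<Zsemi>\<^bsub>D\<^esub> Mu F A (B \<odot>\<^bsub>C\<^esub> E)"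
    and Eps_LUnit: "A \<in> Obj C
          \<Longrightarrow> (Eps F \<otimes>\<^bsub>D\<^esub> Ide D (FObj F A)) \<Zsemi>\<^bsub>D\<^esub> Mu F (Unt C) A \<Zsemi>\<^bsub>D\<^esub> FArr F (LUnit C A)
            = LUnit D (FObj F A)"
    and Eps_RUnit: "A \<in> Obj C
          \<Longrightarrow> (Ide D (FObj F A) \<otimes>\<^bsub>D\<^esub> Eps F) \<Zsemi>\<^bsub>D\<^esub> Mu F A (Unt C) \<Zsemi>\<^bsub>D\<^esub> FArr F (RUnit C A)
            = RUnit D (FObj F A)"
    and Mu_Sym: "\<lbrakk>A \<in> Obj C; B \<in> Obj C\<rbrakk>
          \<Longrightarrow> Mu F A B \<Zsemi>\<^bsub>D\<^esub> FArr F (Sym C A B) = Sym D (FObj F A) (FObj F B) \<Zsemi>\<^bsub>D\<^esub> Mu F B A"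
    and FArr_Copy: "A \<in> Obj C \<Longrightarrow> FArr F (Copy C A) = Copy D (FObj F A) \<Zsemi>\<^bsub>D\<^esub> Mu F A A"
    and FArr_Disc: "A \<in> Obj C \<Longrightarrow> FArr F (Disc C A) = Disc D (FObj F A) \<Zsemi>\<^bsub>D\<^esub> Eps F"


section \<open>Open DAGs and causal models\<close>

text \<open>
  The edges of the DAG are the pairs \<open>(Y, X)\<close> with \<open>Y\<close> in \<open>parents X\<close>. The parents are a list
  rather than a set because the domain of the generator \<open>c\<^sub>X : Pa(X) \<rightarrow> X\<close> is a list of variables.
\<close>

record 'v open_dag =
  verts :: "'v set"
  parents :: "'v \<Rightarrow> 'v list"
  inputs :: "'v set"

definition edge :: "('v, 'z) open_dag_scheme \<Rightarrow> 'v \<Rightarrow> 'v \<Rightarrow> bool" where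
  "edge G Y X \<longleftrightarrow> X \<in> verts G \<and> Y \<in> set (parents G X)"

definition is_open_dag :: "('v, 'z) open_dag_scheme \<Rightarrow> bool" where
  "is_open_dag G \<longleftrightarrow>
     finite (verts G) \<and>
     (\<forall>X \<in> verts G. distinct (parents G X) \<and> set (parents G X) \<subseteq> verts G) \<and>
     acyclic {(Y, X). edge G Y X} \<and>
     inputs G \<subseteq> verts G \<and> (\<forall>X \<in> inputs G. parents G X = [])"

definition noninputs :: "('v, 'z) open_dag_scheme \<Rightarrow> 'v set" where
  "noninputs G = verts G - inputs G"

definition dpath :: "('v, 'z) open_dag_scheme \<Rightarrow> 'v list \<Rightarrow> bool" where
  "dpath G p \<longleftrightarrow> p \<noteq> [] \<and> set p \<subseteq> verts G \<and> successively (edge G) p"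

record ('v, 'o, 'a) causal_model = "'v open_dag" +
  outputs :: "'v set"
  obj_of :: "'v \<Rightarrow> 'o"
  mech_of :: "'v \<Rightarrow> 'a"

fun tensor_list :: "('o, 'a, 'z) markov_data_scheme \<Rightarrow> 'o list \<Rightarrow> 'o" where
  "tensor_list C [] = Unt C"
| "tensor_list C [A] = A"
| "tensor_list C (A # B # As) = A \<odot>\<^bsub>C\<^esub> tensor_list C (B # As)"

definition is_causal_model ::
  "('o, 'a, 'y) markov_data_scheme \<Rightarrow> ('v, 'o, 'a, 'z) causal_model_scheme \<Rightarrow> bool" where
  "is_causal_model C M \<longleftrightarrow>
     is_open_dag M \<and> outputs M \<subseteq> verts M \<and>
     (\<forall>X \<in> verts M. obj_of M X \<in> Obj C) \<and>
     (\<forall>X \<in> noninputs M.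
        mech_of M X \<in> Hom C (tensor_list C (map (obj_of M) (parents M X))) (obj_of M X))"


section \<open>String diagrams and the free Markov category\<close>

datatype 'v diagram =
    Wires "'v list"
  | Box 'v
  | Copies "'v list"
  | Discards "'v list"
  | Swap "'v list" "'v list"
  | Seq "'v diagram" "'v diagram"  (infixl ";;" 55)
  | Par "'v diagram" "'v diagram"  (infixr "\<parallel>" 70)

primrec src :: "('v, 'z) open_dag_scheme \<Rightarrow> 'v diagram \<Rightarrow> 'v list" where
  "src G (Wires A) = A"
| "src G (Box X) = parents G X"
| "src G (Copies A) = A"
| "src G (Discards A) = A"
| "src G (Swap A B) = A @ B"
| "src G (s ;; t) = src G s"
| "src G (s \<parallel> t) = src G s @ src G t"

primrec tgt :: "'v diagram \<Rightarrow> 'v list" where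
  "tgt (Wires A) = A"
| "tgt (Box X) = [X]"
| "tgt (Copies A) = A @ A"
| "tgt (Discards A) = []"
| "tgt (Swap A B) = B @ A"
| "tgt (s ;; t) = tgt t"
| "tgt (s \<parallel> t) = tgt s @ tgt t"

primrec wf_diag :: "('v, 'z) open_dag_scheme \<Rightarrow> 'v diagram \<Rightarrow> bool" where
  "wf_diag G (Wires A) \<longleftrightarrow> set A \<subseteq> verts G"
| "wf_diag G (Box X) \<longleftrightarrow> X \<in> noninputs G"
| "wf_diag G (Copies A) \<longleftrightarrow> set A \<subseteq> verts G"
| "wf_diag G (Discards A) \<longleftrightarrow> set A \<subseteq> verts G"
| "wf_diag G (Swap A B) \<longleftrightarrow> set A \<subseteq> verts G \<and> set B \<subseteq> verts G"
| "wf_diag G (s ;; t) \<longleftrightarrow> wf_diag G s \<and> wf_diag G t \<and> tgt s = src G t"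
| "wf_diag G (s \<parallel> t) \<longleftrightarrow> wf_diag G s \<and> wf_diag G t"

text \<open>
  The congruence generated by the axioms of a strict Markov category: objects are lists, so the
  associator and the unitors are identities. \<open>disc_natural\<close> makes the empty list terminal.
\<close>

inductive diag_eq :: "('v, 'z) open_dag_scheme \<Rightarrow> 'v diagram \<Rightarrow> 'v diagram \<Rightarrow> bool" for G where
  drefl: "wf_diag G t \<Longrightarrow> diag_eq G t t"
| dsym: "diag_eq G s t \<Longrightarrow> diag_eq G t s"
| dtrans: "\<lbrakk>diag_eq G s t; diag_eq G t u\<rbrakk> \<Longrightarrow> diag_eq G s u"
| seq_cong: "\<lbrakk>diag_eq G s s'; diag_eq G t t'; tgt s = src G t\<rbrakk> \<Longrightarrow> diag_eq G (s ;; t) (s' ;; t')"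
| par_cong: "\<lbrakk>diag_eq G s s'; diag_eq G t t'\<rbrakk> \<Longrightarrow> diag_eq G (s \<parallel> t) (s' \<parallel> t')"
| seq_assoc: "wf_diag G (s ;; t ;; u) \<Longrightarrow> diag_eq G (s ;; t ;; u) (s ;; (t ;; u))"
| id_seq: "wf_diag G t \<Longrightarrow> diag_eq G (Wires (src G t) ;; t) t"
| seq_id: "wf_diag G t \<Longrightarrow> diag_eq G (t ;; Wires (tgt t)) t"
| par_assoc: "wf_diag G ((s \<parallel> t) \<parallel> u) \<Longrightarrow> diag_eq G ((s \<parallel> t) \<parallel> u) (s \<parallel> (t \<parallel> u))"
| unit_par: "wf_diag G t \<Longrightarrow> diag_eq G (Wires [] \<parallel> t) t"
| par_unit: "wf_diag G t \<Longrightarrow> diag_eq G (t \<parallel> Wires []) t"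
| id_par_id: "wf_diag G (Wires (A @ B)) \<Longrightarrow> diag_eq G (Wires A \<parallel> Wires B) (Wires (A @ B))"
| interchange: "\<lbrakk>wf_diag G (s ;; t); wf_diag G (s' ;; t')\<rbrakk>
    \<Longrightarrow> diag_eq G ((s ;; t) \<parallel> (s' ;; t')) ((s \<parallel> s') ;; (t \<parallel> t'))"
| swap_natural: "wf_diag G (s \<parallel> t)
    \<Longrightarrow> diag_eq G ((s \<parallel> t) ;; Swap (tgt s) (tgt t)) (Swap (src G s) (src G t) ;; (t \<parallel> s))"
| swap_swap: "wf_diag G (Swap A B) \<Longrightarrow> diag_eq G (Swap A B ;; Swap B A) (Wires (A @ B))"
| swap_hexagon: "wf_diag G (Wires (A @ B @ C))
    \<Longrightarrow> diag_eq G (Swap A (B @ C)) ((Swap A B \<parallel> Wires C) ;; (Wires B \<parallel> Swap A C))"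
| copy_coassoc: "wf_diag G (Wires A)
    \<Longrightarrow> diag_eq G (Copies A ;; (Copies A \<parallel> Wires A)) (Copies A ;; (Wires A \<parallel> Copies A))"
| copy_left_counit: "wf_diag G (Wires A) \<Longrightarrow> diag_eq G (Copies A ;; (Discards A \<parallel> Wires A)) (Wires A)"
| copy_right_counit: "wf_diag G (Wires A) \<Longrightarrow> diag_eq G (Copies A ;; (Wires A \<parallel> Discards A)) (Wires A)"
| copy_comm: "wf_diag G (Wires A) \<Longrightarrow> diag_eq G (Copies A ;; Swap A A) (Copies A)"
| copy_append: "wf_diag G (Wires (A @ B))
    \<Longrightarrow> diag_eq G (Copies (A @ B)) ((Copies A \<parallel> Copies B) ;; (Wires A \<parallel> Swap A B \<parallel> Wires B))"
| disc_append: "wf_diag G (Wires (A @ B)) \<Longrightarrow> diag_eq G (Discards (A @ B)) (Discards A \<parallel> Discards B)"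
| copy_unit: "diag_eq G (Copies []) (Wires [])"
| disc_unit: "diag_eq G (Discards []) (Wires [])"
| disc_natural: "\<lbrakk>wf_diag G t; tgt t = []\<rbrakk> \<Longrightarrow> diag_eq G t (Discards (src G t))"

definition cls :: "('v, 'z) open_dag_scheme \<Rightarrow> 'v diagram \<Rightarrow> 'v diagram set" where
  "cls G t = {s. diag_eq G t s}"

definition rep :: "'v diagram set \<Rightarrow> 'v diagram" where
  "rep f = (SOME t. t \<in> f)"

definition free_markov ::
  "('v, 'z) open_dag_scheme \<Rightarrow> ('v list, 'v diagram set) markov_data" where
  "free_markov G = \<lparr>
     Obj = lists (verts G),
     Arr = cls G ` {t. wf_diag G t},
     Dom = (\<lambda>f. src G (rep f)),
     Cod = (\<lambda>f. tgt (rep f)),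
     Ide = (\<lambda>A. cls G (Wires A)),
     Cmp = (\<lambda>f g. cls G (rep f ;; rep g)),
     TenO = (@),
     TenA = (\<lambda>f g. cls G (rep f \<parallel> rep g)),
     Unt = [],
     Assoc = (\<lambda>A B C. cls G (Wires (A @ B @ C))),
     LUnit = (\<lambda>A. cls G (Wires A)),
     RUnit = (\<lambda>A. cls G (Wires A)),
     Sym = (\<lambda>A B. cls G (Swap A B)),
     Copy = (\<lambda>A. cls G (Copies A)),
     Disc = (\<lambda>A. cls G (Discards A)) \<rparr>"

lemma wf_diag_verts:
  "is_open_dag G \<Longrightarrow> wf_diag G t \<Longrightarrow> set (src G t) \<subseteq> verts G \<and> set (tgt t) \<subseteq> verts G"
  by (induction t) (auto simp: is_open_dag_def noninputs_def)

lemma diag_eq_types: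
  assumes "is_open_dag G" and "diag_eq G s t"
  shows "wf_diag G s \<and> wf_diag G t \<and> src G s = src G t \<and> tgt s = tgt t"
  using assms(2) wf_diag_verts[OF assms(1)]
  by (induction rule: diag_eq.induct) fastforce+

lemma cls_eqI: "diag_eq G s t \<Longrightarrow> cls G s = cls G t"
  unfolding cls_def by (rule Collect_cong, rule iffI) (blast intro: diag_eq.dsym diag_eq.dtrans)+

lemma cls_eq_iff:
  assumes "wf_diag G t"
  shows "cls G s = cls G t \<longleftrightarrow> diag_eq G s t"
proof
  assume "cls G s = cls G t"
  moreover have "t \<in> cls G t"
    using assms by (simp add: cls_def diag_eq.drefl)
  ultimately show "diag_eq G s t"
    by (metis cls_def mem_Collect_eq)
qed (rule cls_eqI)

lemma diag_eq_rep: "wf_diag G t \<Longrightarrow> diag_eq G t (rep (cls G t))"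
  unfolding rep_def cls_def by (rule someI2[of _ t]) (auto intro: diag_eq.drefl)

lemma free_Hom:
  assumes "is_open_dag G"
  shows "f \<in> Hom (free_markov G) A B \<longleftrightarrow> (\<exists>t. f = cls G t \<and> wf_diag G t \<and> src G t = A \<and> tgt t = B)"
proof -
  have rep: "src G (rep (cls G t)) = src G t \<and> tgt (rep (cls G t)) = tgt t" if "wf_diag G t" for t
    using diag_eq_types[OF assms diag_eq_rep[OF that]] by simp
  show ?thesis
    unfolding Hom_def free_markov_def by (auto simp: image_iff rep)
qed

lemma free_simps [simp]:
  "Obj (free_markov G) = lists (verts G)"
  "TenO (free_markov G) = (@)"
  "Unt (free_markov G) = []"
  "Ide (free_markov G) A = cls G (Wires A)"
  "Assoc (free_markov G) A B C = cls G (Wires (A @ B @ C))"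
  "LUnit (free_markov G) A = cls G (Wires A)"
  "RUnit (free_markov G) A = cls G (Wires A)"
  "Sym (free_markov G) A B = cls G (Swap A B)"
  "Copy (free_markov G) A = cls G (Copies A)"
  "Disc (free_markov G) A = cls G (Discards A)"
  by (simp_all add: free_markov_def)

lemma free_Cmp [simp]:
  assumes "is_open_dag G" "wf_diag G s" "wf_diag G t" "tgt s = src G t"
  shows "cls G s \<Zsemi>\<^bsub>free_markov G\<^esub> cls G t = cls G (s ;; t)"
  using assms diag_eq_types[OF assms(1) diag_eq_rep]
  by (simp add: free_markov_def) (intro cls_eqI diag_eq.seq_cong diag_eq.dsym[OF diag_eq_rep]; simp)

lemma free_TenA [simp]:
  assumes "wf_diag G s" "wf_diag G t"
  shows "cls G s \<otimes>\<^bsub>free_markov G\<^esub> cls G t = cls G (s \<parallel> t)"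
  using assms
  by (simp add: free_markov_def) (intro cls_eqI diag_eq.par_cong diag_eq.dsym[OF diag_eq_rep]; simp)


lemma free_inverse_id:
  assumes "is_open_dag G" "set A \<subseteq> verts G"
  shows "inverse_arrs (free_markov G) (cls G (Wires A)) (cls G (Wires A))"
    and "Inv (free_markov G) (cls G (Wires A)) = cls G (Wires A)"
proof -
  let ?F = "free_markov G" and ?i = "cls G (Wires A)"
  have h: "?i \<in> Hom ?F A A"
    using assms by (auto simp: free_Hom)
  hence t: "?i \<in> Arr ?F" "Dom ?F ?i = A" "Cod ?F ?i = A"
    by (auto simp: Hom_def)
  have "cls G (Wires A ;; Wires A) = ?i"
    using assms diag_eq.id_seq[of G "Wires A"] by (auto intro!: cls_eqI)
  thus inv: "inverse_arrs ?F ?i ?i"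
    using assms h t by (simp add: inverse_arrs_def)
  show "Inv ?F ?i = ?i"
    unfolding Inv_def
  proof (rule the_equality[of "inverse_arrs ?F ?i", OF inv])
    fix g assume g: "inverse_arrs ?F ?i g"
    then obtain u where u: "g = cls G u" "wf_diag G u" "src G u = A" "tgt u = A"
      using t by (auto simp: inverse_arrs_def free_Hom[OF assms(1)])
    have "?i \<Zsemi>\<^bsub>?F\<^esub> g = cls G (Wires A ;; u)"
      using assms u by simp
    also have "\<dots> = g"
      using diag_eq.id_seq[OF u(2)] u by (auto intro!: cls_eqI)
    finally show "g = ?i"
      using g t by (simp add: inverse_arrs_def)
  qed
qed

theorem free_markov_category:
  assumes G: "is_open_dag G"
  shows "markov_category (free_markov G)"
proof -
  note H = free_Hom[OF G] and V = wf_diag_verts[OF G] and T = diag_eq_types[OF G]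
  have ii: "cls G (Wires A ;; Wires A) = cls G (Wires A)" if "set A \<subseteq> verts G" for A
    using that diag_eq.id_seq[of G "Wires A"] by (auto intro!: cls_eqI)
  have pp: "cls G (Wires A \<parallel> Wires B) = cls G (Wires (A @ B))"
    if "set A \<subseteq> verts G" "set B \<subseteq> verts G" for A B
    using that diag_eq.id_par_id[of G A B] by (auto intro!: cls_eqI)
  have si: "cls G (t ;; Wires A) = cls G t" if "wf_diag G t" "tgt t = A" for t A
    using that diag_eq.seq_id[of G t] by (auto intro!: cls_eqI)
  have il: "cls G (Wires A ;; t) = cls G t" if "wf_diag G t" "src G t = A" for t A
    using that diag_eq.id_seq[of G t] by (auto intro!: cls_eqI)
  have cS: "cls G (s ;; t) = cls G (s' ;; t')"
    if "cls G s = cls G s'" "cls G t = cls G t'" "wf_diag G s" "wf_diag G t" "tgt s = src G t" for s s' t t'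
    using that by (metis cls_eqI cls_eq_iff diag_eq.dsym diag_eq.seq_cong)
  have cP: "cls G (s \<parallel> t) = cls G (s' \<parallel> t')"
    if "cls G s = cls G s'" "cls G t = cls G t'" "wf_diag G s" "wf_diag G t" for s s' t t'
    using that by (metis cls_eqI cls_eq_iff diag_eq.dsym diag_eq.par_cong)
  have iso: "iso_arr (free_markov G) (cls G (Wires A))" if "set A \<subseteq> verts G" for A
    using free_inverse_id[OF G that] by (auto simp: iso_arr_def)
  have Vs: "set (src G t) \<subseteq> verts G" "set (tgt t) \<subseteq> verts G" if "wf_diag G t" for t
    using V[OF that] by auto
  have cat: "category (free_markov G)"
  proof (unfold_locales, goal_cases)
    case (1 f)
    then show ?case using V T[OF diag_eq_rep]
      by (fastforce simp: free_markov_def in_lists_conv_set)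
  next
    case (2 f)
    then show ?case using V T[OF diag_eq_rep]
      by (fastforce simp: free_markov_def in_lists_conv_set)
  next
    case (3 A)
    then show ?case by (auto simp: H in_lists_conv_set intro!: exI[of _ "Wires A"])
  next
    case (4 f A B g D)
    then obtain s t where "f = cls G s" "g = cls G t" "wf_diag G (s ;; t)" "src G s = A" "tgt t = D"
      by (auto simp: H)
    then show ?case using G by (auto simp: H intro!: exI[of _ "s ;; t"])
  next
    case (5 f A B)
    then show ?case using G by (auto simp: H il Vs)
  next
    case (6 f A B)
    then show ?case using G by (auto simp: H si Vs)
  next
    case (7 f A B g D h E)
    then show ?case using G by (auto simp: H cls_eqI[OF diag_eq.seq_assoc])
  qed
  then interpret category "free_markov G" .
  have smc: "symmetric_monoidal_category (free_markov G)"
  proof (unfold_locales, goal_cases)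
    case 1 show ?case by simp
  next
    case (2 A B) then show ?case by simp
  next
    case (3 f A B g A' B')
    then obtain s t where "f = cls G s" "g = cls G t" "wf_diag G (s \<parallel> t)" "src G s = A" "tgt s = B"
        "src G t = A'" "tgt t = B'"
      by (auto simp: H)
    then show ?case by (auto simp: H intro!: exI[of _ "s \<parallel> t"])
  next
    case (4 A B) then show ?case by (auto simp: in_lists_conv_set subset_iff intro!: pp)
  next
    case (5 f A B g D f' A' B' g' D')
    then show ?case using G by (auto simp: H cls_eqI[OF diag_eq.interchange])
  next
    case (6 A B D)
    then show ?case by (auto simp: H in_lists_conv_set intro!: exI[of _ "Wires (A @ B @ D)"])
  next
    case (7 A B D)
    then show ?case by (auto simp: in_lists_conv_set intro!: iso)
  next
    case (8 f A A' g B B' h D D')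
    then show ?case using G
      by (auto simp: H si il Vs cls_eqI[OF diag_eq.par_assoc])
  next
    case (9 A)
    then show ?case by (auto simp: H in_lists_conv_set intro!: exI[of _ "Wires A"])
  next
    case (10 A)
    then show ?case by (auto simp: in_lists_conv_set intro!: iso)
  next
    case (11 f A B)
    then show ?case using G
      by (auto simp: H si il Vs cls_eqI[OF diag_eq.unit_par])
  next
    case (12 A)
    then show ?case by (auto simp: H in_lists_conv_set intro!: exI[of _ "Wires A"])
  next
    case (13 A)
    then show ?case by (auto simp: in_lists_conv_set intro!: iso)
  next
    case (14 f A B)
    then show ?case using G
      by (auto simp: H si il Vs cls_eqI[OF diag_eq.par_unit])
  next
    case (15 A B D E)
    then have sub: "set A \<subseteq> verts G" "set B \<subseteq> verts G" "set D \<subseteq> verts G" "set E \<subseteq> verts G"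
      by auto
    then show ?case using G by (simp add: pp ii)
  next
    case (16 A B)
    then have sub: "set A \<subseteq> verts G" "set B \<subseteq> verts G"
      by auto
    then show ?case using G by (simp add: pp ii)
  next
    case (17 A B)
    then show ?case by (auto simp: H intro!: exI[of _ "Swap A B"])
  next
    case (18 f A A' g B B')
    then show ?case using G V
      by (auto simp: H Vs cls_eqI[OF diag_eq.swap_natural])
  next
    case (19 A B)
    then have sub: "set A \<subseteq> verts G" "set B \<subseteq> verts G"
      by auto
    then show ?case using G by (simp add: cls_eqI[OF diag_eq.swap_swap])
  next
    case (20 A B D)
    then have sub: "set A \<subseteq> verts G" "set B \<subseteq> verts G" "set D \<subseteq> verts G"
      by auto
    then show ?case using G
      by (simp add: il si cS[OF si refl] cls_eqI[OF diag_eq.swap_hexagon])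
  qed
  then interpret symmetric_monoidal_category "free_markov G" .
  show ?thesis
  proof (unfold_locales, goal_cases)
    case (1 A)
    then show ?case by (auto simp: H intro!: exI[of _ "Copies A"])
  next
    case (2 A)
    then show ?case by (auto simp: H intro!: exI[of _ "Discards A"])
  next
    case (3 A)
    then have sub: "set A \<subseteq> verts G"
      by auto
    then show ?case using G by (simp add: si cls_eqI[OF diag_eq.copy_coassoc])
  next
    case (4 A)
    then have sub: "set A \<subseteq> verts G"
      by auto
    then show ?case using G by (simp add: si cls_eqI[OF diag_eq.copy_left_counit])
  next
    case (5 A)
    then have sub: "set A \<subseteq> verts G"
      by auto
    then show ?case using G by (simp add: si cls_eqI[OF diag_eq.copy_right_counit])
  next
    case (6 A)
    then have sub: "set A \<subseteq> verts G"
      by auto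
    then show ?case using G by (simp add: cls_eqI[OF diag_eq.copy_comm])
  next
    case (7 A B)
    then have sub: "set A \<subseteq> verts G" "set B \<subseteq> verts G"
      by auto
    have a: "cls G (Wires (A @ B @ B) ;; Swap A B \<parallel> Wires B ;; Wires (B @ A @ B)) = cls G (Swap A B \<parallel> Wires B)"
      using sub by (simp add: si il cS[OF il refl])
    have b: "cls G (Wires A \<parallel> (Wires (A @ B @ B) ;; Swap A B \<parallel> Wires B ;; Wires (B @ A @ B)))
        = cls G (Wires A \<parallel> Swap A B \<parallel> Wires B)"
      using sub by (intro cP a) auto
    have c: "cls G (Copies A \<parallel> Copies B ;; (Wires A \<parallel> (Wires (A @ B @ B) ;; Swap A B \<parallel> Wires B ;; Wires (B @ A @ B))))
        = cls G (Copies (A @ B))"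
      using sub cls_eqI[OF diag_eq.copy_append[of G A B]] by (subst cS[OF refl b]) auto
    show ?case using G sub c cls_eqI[OF diag_eq.copy_append[of G A B]]
      by (simp add: mid_swap_def free_inverse_id si il cS[OF refl si] cS[OF refl il])
  next
    case (8 A B)
    then have sub: "set A \<subseteq> verts G" "set B \<subseteq> verts G"
      by auto
    then show ?case using G by (simp add: si cls_eqI[OF diag_eq.disc_append])
  next
    case 9
    then show ?case using G by (simp add: si cls_eqI[OF diag_eq.copy_unit])
  next
    case 10
    then show ?case by (simp add: cls_eqI[OF diag_eq.disc_unit])
  next
    case (11 f A)
    then show ?case by (auto simp: H cls_eqI[OF diag_eq.disc_natural])
  qed
qed


section \<open>Network diagrams\<close>

text \<open>
  Two wires of a diagram count as the same if they are connected by copy maps. A wire in this sense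
  comes either from an input of the diagram or from the unique output of an occurrence of a box.
  The former are numbered \<open>0, 1, \<dots>\<close> in the order of \<open>src G t\<close>, and the latter continue the
  numbering in the order of \<open>boxes t\<close>.

  In the auxiliary functions \<open>flow\<close> and \<open>feeds\<close>, \<open>ws\<close> are the wires entering the subdiagram and \<open>n\<close>
  is the number of the output wire of its first box. \<open>flow\<close> yields the wires leaving the subdiagram,
  and \<open>feeds\<close> lists, for each box in the order of \<open>boxes\<close>, the wires entering this box.
\<close>

primrec boxes :: "'v diagram \<Rightarrow> 'v list" where
  "boxes (Wires A) = []"
| "boxes (Box X) = [X]"
| "boxes (Copies A) = []"
| "boxes (Discards A) = []"
| "boxes (Swap A B) = []"
| "boxes (s ;; t) = boxes s @ boxes t"
| "boxes (s \<parallel> t) = boxes s @ boxes t"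

primrec flow :: "('v, 'z) open_dag_scheme \<Rightarrow> 'v diagram \<Rightarrow> nat \<Rightarrow> nat list \<Rightarrow> nat list" where
  "flow G (Wires A) n ws = ws"
| "flow G (Box X) n ws = [n]"
| "flow G (Copies A) n ws = ws @ ws"
| "flow G (Discards A) n ws = []"
| "flow G (Swap A B) n ws = drop (length A) ws @ take (length A) ws"
| "flow G (s ;; t) n ws = flow G t (n + length (boxes s)) (flow G s n ws)"
| "flow G (s \<parallel> t) n ws =
     flow G s n (take (length (src G s)) ws) @
     flow G t (n + length (boxes s)) (drop (length (src G s)) ws)"

primrec feeds :: "('v, 'z) open_dag_scheme \<Rightarrow> 'v diagram \<Rightarrow> nat \<Rightarrow> nat list \<Rightarrow> nat list list" where
  "feeds G (Wires A) n ws = []"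
| "feeds G (Box X) n ws = [ws]"
| "feeds G (Copies A) n ws = []"
| "feeds G (Discards A) n ws = []"
| "feeds G (Swap A B) n ws = []"
| "feeds G (s ;; t) n ws = feeds G s n ws @ feeds G t (n + length (boxes s)) (flow G s n ws)"
| "feeds G (s \<parallel> t) n ws =
     feeds G s n (take (length (src G s)) ws) @
     feeds G t (n + length (boxes s)) (drop (length (src G s)) ws)"

definition labels :: "('v, 'z) open_dag_scheme \<Rightarrow> 'v diagram \<Rightarrow> 'v list" where
  "labels G t = src G t @ boxes t"

definition box_wire :: "('v, 'z) open_dag_scheme \<Rightarrow> 'v diagram \<Rightarrow> nat \<Rightarrow> nat" where
  "box_wire G t k = length (src G t) + k"

definition output_wires :: "('v, 'z) open_dag_scheme \<Rightarrow> 'v diagram \<Rightarrow> nat list" where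
  "output_wires G t = flow G t (length (src G t)) [0..<length (src G t)]"

definition box_inputs :: "('v, 'z) open_dag_scheme \<Rightarrow> 'v diagram \<Rightarrow> nat list list" where
  "box_inputs G t = feeds G t (length (src G t)) [0..<length (src G t)]"

definition network :: "('v, 'z) open_dag_scheme \<Rightarrow> 'v diagram \<Rightarrow> bool" where
  "network G t \<longleftrightarrow>
     wf_diag G t \<and>
     (\<forall>w < length (labels G t). \<forall>w' < length (labels G t).
        w \<noteq> w' \<longrightarrow> labels G t ! w \<noteq> labels G t ! w') \<and>
     distinct (map (\<lambda>w. labels G t ! w) (output_wires G t)) \<and>
     (\<forall>ins \<in> set (box_inputs G t). distinct (map (\<lambda>w. labels G t ! w) ins))"

definition wire_step :: "('v, 'z) open_dag_scheme \<Rightarrow> 'v diagram \<Rightarrow> (nat \<times> nat) set" where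
  "wire_step G t =
     {(w, box_wire G t k) | w k. k < length (boxes t) \<and> w \<in> set (box_inputs G t ! k)}"

definition normalised :: "('v, 'z) open_dag_scheme \<Rightarrow> 'v diagram \<Rightarrow> bool" where
  "normalised G t \<longleftrightarrow>
     (\<forall>k < length (boxes t). \<exists>w \<in> set (output_wires G t). (box_wire G t k, w) \<in> (wire_step G t)\<^sup>*)"

definition is_network :: "('v, 'z) open_dag_scheme \<Rightarrow> 'v diagram set \<Rightarrow> bool" where
  "is_network G f \<longleftrightarrow> f \<in> Arr (free_markov G) \<and> (\<exists>t \<in> f. network G t)"

definition is_normalised_network :: "('v, 'z) open_dag_scheme \<Rightarrow> 'v diagram set \<Rightarrow> bool" where
  "is_normalised_network G f \<longleftrightarrow>
     f \<in> Arr (free_markov G) \<and> (\<exists>t \<in> f. network G t \<and> normalised G t)"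

text \<open>
  The network diagram \<open>D : V\<^sup>i\<^sup>n \<rightarrow> V\<^sup>o\<^sup>u\<^sup>t\<close> of a model, for some listing of the two sets. In a network
  diagram each variable labels only one wire, so the wiring is forced once the inputs, the outputs
  and the boxes are given.
\<close>

definition model_network :: "('v, 'o, 'a, 'z) causal_model_scheme \<Rightarrow> 'v diagram set \<Rightarrow> bool" where
  "model_network M D \<longleftrightarrow>
     D \<in> Arr (free_markov M) \<and>
     (\<exists>t \<in> D. network M t \<and>
        distinct (src M t) \<and> set (src M t) = inputs M \<and>
        distinct (tgt t) \<and> set (tgt t) = outputs M \<and>
        distinct (boxes t) \<and>
        set (boxes t) = {X \<in> noninputs M. \<exists>p. dpath M p \<and> hd p = X \<and> last p \<in> outputs M})"

lemma length_boxes_feeds [simp]: "length (feeds G t n ws) = length (boxes t)"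
  by (induction t arbitrary: n ws) auto

lemma flow_feeds_labels:
  assumes "wf_diag G t" "map l ws = src G t" "map l [n..<n + length (boxes t)] = boxes t"
  shows "map l (flow G t n ws) = tgt t \<and>
         map (map l) (feeds G t n ws) = map (parents G) (boxes t)"
  using assms
proof (induction t arbitrary: n ws)
  case (Seq s t)
  have "map l [n..<n + length (boxes s)] @ map l [n + length (boxes s)..<n + length (boxes s) + length (boxes t)]
      = boxes s @ boxes t"
    using Seq.prems(3) upt_add_eq_append[of n "n + length (boxes s)" "length (boxes t)"]
    by (simp add: add.assoc flip: map_append)
  then have "map l [n..<n + length (boxes s)] = boxes s"
    "map l [n + length (boxes s)..<n + length (boxes s) + length (boxes t)] = boxes t"
    by (simp_all add: append_eq_append_conv)
  then show ?case
    using Seq.prems Seq.IH(1)[of ws n] Seq.IH(2)[of "flow G s n ws" "n + length (boxes s)"] by simp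
next
  case (Par s t)
  have "map l [n..<n + length (boxes s)] @ map l [n + length (boxes s)..<n + length (boxes s) + length (boxes t)]
      = boxes s @ boxes t"
    using Par.prems(3) upt_add_eq_append[of n "n + length (boxes s)" "length (boxes t)"]
    by (simp add: add.assoc flip: map_append)
  then have "map l [n..<n + length (boxes s)] = boxes s"
    "map l [n + length (boxes s)..<n + length (boxes s) + length (boxes t)] = boxes t"
    by (simp_all add: append_eq_append_conv)
  moreover have "map l (take (length (src G s)) ws) = src G s" "map l (drop (length (src G s)) ws) = src G t"
    using Par.prems(2) by (simp_all flip: take_map drop_map)
  ultimately show ?case
    using Par.prems Par.IH(1)[of "take (length (src G s)) ws" n]
      Par.IH(2)[of "drop (length (src G s)) ws" "n + length (boxes s)"] by simp
qed (auto simp flip: take_map drop_map)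

lemma network_iff:
  assumes "is_open_dag G" "wf_diag G t"
  shows "network G t \<longleftrightarrow> distinct (src G t @ boxes t) \<and> distinct (tgt t)"
proof -
  let ?l = "\<lambda>w. labels G t ! w" and ?n = "length (src G t)"
  have "map ?l [0..<?n] = src G t"
    by (rule nth_equalityI) (auto simp: labels_def nth_append)
  moreover have "map ?l [?n..<?n + length (boxes t)] = boxes t"
    by (rule nth_equalityI) (auto simp: labels_def nth_append)
  ultimately have lab: "map ?l (output_wires G t) = tgt t"
      "map (map ?l) (box_inputs G t) = map (parents G) (boxes t)"
    using flow_feeds_labels[OF assms(2), of ?l "[0..<?n]" ?n]
    by (auto simp: output_wires_def box_inputs_def)
  have "set (boxes t) \<subseteq> verts G"
    using assms(2) by (induction t) (auto simp: noninputs_def)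
  then have "distinct ps" if "ps \<in> set (map (parents G) (boxes t))" for ps
    using that assms(1) by (auto simp: is_open_dag_def)
  moreover have "map ?l ins \<in> set (map (map ?l) (box_inputs G t))" if "ins \<in> set (box_inputs G t)" for ins
    using that by simp
  ultimately have ins: "\<forall>ins \<in> set (box_inputs G t). distinct (map ?l ins)"
    unfolding lab(2) by blast
  have wires: "(\<forall>w < length (labels G t). \<forall>w' < length (labels G t).
        w \<noteq> w' \<longrightarrow> labels G t ! w \<noteq> labels G t ! w') \<longleftrightarrow> distinct (labels G t)"
    unfolding distinct_conv_nth by (rule refl)
  show ?thesis
    using assms(2) ins unfolding network_def wires lab(1) unfolding labels_def by blast
qed

primrec select :: "'v list \<Rightarrow> 'v list \<Rightarrow> 'v diagram" where
  "select A [] = Discards A"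
| "select A (X # B) =
     Copies A ;; (Discards (takeWhile (\<lambda>Y. Y \<noteq> X) A) \<parallel> Wires [X] \<parallel> Discards (tl (dropWhile (\<lambda>Y. Y \<noteq> X) A)))
       \<parallel> select A B"

lemma select:
  assumes "set B \<subseteq> set A" "set A \<subseteq> verts G"
  shows "wf_diag G (select A B) \<and> src G (select A B) = A \<and> tgt (select A B) = B \<and> boxes (select A B) = []"
  using assms
proof (induction B)
  case (Cons X B)
  then have "dropWhile (\<lambda>Y. Y \<noteq> X) A \<noteq> []"
    by (auto simp: dropWhile_eq_Nil_conv)
  then have "dropWhile (\<lambda>Y. Y \<noteq> X) A = X # tl (dropWhile (\<lambda>Y. Y \<noteq> X) A)"
    using hd_dropWhile[of "\<lambda>Y. Y \<noteq> X" A] by (metis list.collapse)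
  then have "takeWhile (\<lambda>Y. Y \<noteq> X) A @ X # tl (dropWhile (\<lambda>Y. Y \<noteq> X) A) = A"
    by (metis takeWhile_dropWhile_id)
  moreover from this have "set (takeWhile (\<lambda>Y. Y \<noteq> X) A) \<subseteq> set A" "set (tl (dropWhile (\<lambda>Y. Y \<noteq> X) A)) \<subseteq> set A"
    by (metis set_append Un_upper1, metis set_append set_subset_Cons Un_upper2 subset_trans)
  ultimately show ?case using Cons by auto
qed auto

lemma network_exists:
  assumes "is_open_dag G" "finite U" "U \<subseteq> noninputs G" "set A \<subseteq> verts G" "distinct A"
    "set A \<inter> U = {}" "\<And>X. X \<in> U \<Longrightarrow> set (parents G X) \<subseteq> set A \<union> U" "set B \<subseteq> set A \<union> U"
  shows "\<exists>t. wf_diag G t \<and> src G t = A \<and> tgt t = B \<and> distinct (boxes t) \<and> set (boxes t) = U"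
  using assms(2-)
proof (induction "card U" arbitrary: U A)
  case 0
  then show ?case using select[of B A G] by (intro exI[of _ "select A B"]) auto
next
  case (Suc n)
  let ?r = "{(Y, X). edge G Y X}"
  have "?r \<subseteq> verts G \<times> verts G"
    using assms(1) by (auto simp: edge_def is_open_dag_def)
  then have "finite ?r" "acyclic ?r"
    using assms(1) finite_subset[of ?r] by (auto simp: is_open_dag_def)
  then have "wf ?r" by (rule finite_acyclic_wf)
  moreover have "U \<noteq> {}" using Suc by auto
  ultimately obtain X where X: "X \<in> U" "\<And>Y. edge G Y X \<Longrightarrow> Y \<notin> U"
    by (metis (no_types, lifting) case_prod_conv ex_in_conv mem_Collect_eq wfE_min)
  then have V: "X \<in> verts G" using Suc by (auto simp: noninputs_def)
  then have pa: "set (parents G X) \<subseteq> set A"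
    using X Suc.prems(6)[of X] by (auto simp: edge_def)
  have "\<exists>t. wf_diag G t \<and> src G t = X # A \<and> tgt t = B \<and> distinct (boxes t) \<and> set (boxes t) = U - {X}"
  proof (rule Suc.hyps(1))
    show "set (parents G Z) \<subseteq> set (X # A) \<union> (U - {X})" if "Z \<in> U - {X}" for Z
      using Suc.prems(6)[of Z] that by auto
  qed (use Suc.prems Suc.hyps(2) X V in auto)
  then obtain t where "wf_diag G t" "src G t = X # A" "tgt t = B" "distinct (boxes t)" "set (boxes t) = U - {X}"
    by blast
  then show ?case
    using X Suc.prems select[OF pa, of G]
    by (intro exI[of _ "Copies A ;; ((select A (parents G X) ;; Box X) \<parallel> Wires A) ;; t"]) auto
qed

theorem model_network_exists:
  assumes "is_causal_model C M"
  shows "\<exists>D. model_network M D"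
proof -
  have G: "is_open_dag M" and out: "outputs M \<subseteq> verts M"
    using assms by (auto simp: is_causal_model_def)
  let ?U = "{X \<in> noninputs M. \<exists>p. dpath M p \<and> hd p = X \<and> last p \<in> outputs M}"
  have fin: "finite (verts M)" "finite (inputs M)" "finite (outputs M)"
    using G out by (auto simp: is_open_dag_def intro: finite_subset)
  obtain A where A: "set A = inputs M" "distinct A" using finite_distinct_list[OF fin(2)] by blast
  obtain B where B: "set B = outputs M" "distinct B" using finite_distinct_list[OF fin(3)] by blast
  have pa: "set (parents M X) \<subseteq> set A \<union> ?U" if "X \<in> ?U" for X
  proof
    fix Y assume Y: "Y \<in> set (parents M X)"
    from that obtain p where p: "dpath M p" "hd p = X" "last p \<in> outputs M" by blast
    have e: "Y \<in> verts M" "edge M Y X"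
      using that Y G by (auto simp: noninputs_def is_open_dag_def edge_def)
    then have "dpath M (Y # p) \<and> hd (Y # p) = Y \<and> last (Y # p) \<in> outputs M"
      using p by (auto simp: dpath_def successively_Cons)
    then have "Y \<in> ?U" if "Y \<notin> inputs M"
      using e(1) that unfolding noninputs_def by blast
    then show "Y \<in> set A \<union> ?U"
      using A(1) by blast
  qed
  have B': "set B \<subseteq> set A \<union> ?U"
  proof
    fix X assume "X \<in> set B"
    then have "X \<in> verts M" "dpath M [X] \<and> hd [X] = X \<and> last [X] \<in> outputs M"
      using out B by (auto simp: dpath_def)
    then show "X \<in> set A \<union> ?U"
      unfolding A(1) noninputs_def by blast
  qed
  have "finite ?U" "?U \<subseteq> noninputs M" "set A \<subseteq> verts M" "set A \<inter> ?U = {}"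
    using A G fin by (auto simp: noninputs_def is_open_dag_def)
  from network_exists[OF G this(1-3) A(2) this(4) pa B']
  have "\<exists>t. wf_diag M t \<and> src M t = A \<and> tgt t = B \<and> distinct (boxes t) \<and> set (boxes t) = ?U" .
  then obtain t where t: "wf_diag M t" "src M t = A" "tgt t = B" "distinct (boxes t)" "set (boxes t) = ?U"
    by blast
  have "network M t"
    unfolding network_iff[OF G t(1)] using t(2-5) A B by (auto simp: noninputs_def)
  moreover have "t \<in> cls M t" "cls M t \<in> Arr (free_markov M)"
    using t(1) by (auto simp: cls_def free_markov_def intro: diag_eq.drefl)
  ultimately show ?thesis
    using t A B unfolding model_network_def by blast
qed


section \<open>Structural well-behavedness\<close>

definition var_image ::
  "('h list, 'h diagram set, 'l list, 'l diagram set) monoidal_functor \<Rightarrow> 'h \<Rightarrow> 'l list" where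
  "var_image F X = FObj F [X]"

text \<open>\<open>\<pi>(S) \<subseteq> T\<close> and \<open>\<pi>(S) = T\<close>, which include that the concatenation has no repetitions; neither
  depends on the listing \<open>xs\<close> of \<open>S\<close>.\<close>

definition image_into ::
  "('h list, 'h diagram set, 'l list, 'l diagram set) monoidal_functor \<Rightarrow> 'h set \<Rightarrow> 'l set \<Rightarrow> bool" where
  "image_into F S T \<longleftrightarrow>
     (\<exists>xs. distinct xs \<and> set xs = S \<and>
       distinct (concat (map (var_image F) xs)) \<and> set (concat (map (var_image F) xs)) \<subseteq> T)"

definition image_onto ::
  "('h list, 'h diagram set, 'l list, 'l diagram set) monoidal_functor \<Rightarrow> 'h set \<Rightarrow> 'l set \<Rightarrow> bool" where
  "image_onto F S T \<longleftrightarrow>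
     (\<exists>xs. distinct xs \<and> set xs = S \<and>
       distinct (concat (map (var_image F) xs)) \<and> set (concat (map (var_image F) xs)) = T)"

definition mech_vars ::
  "('h, 'y) open_dag_scheme \<Rightarrow> ('l, 'z) open_dag_scheme \<Rightarrow> ('h \<Rightarrow> 'l set) \<Rightarrow> 'h \<Rightarrow> 'l set" where
  "mech_vars G\<^sub>H G\<^sub>L \<pi> X =
     {Z \<in> verts G\<^sub>L. \<exists>p. dpath G\<^sub>L p \<and> hd p = Z \<and> last p \<in> \<pi> X \<and>
        set p \<inter> (\<Union>Y \<in> set (parents G\<^sub>H X). \<pi> Y) = {}}"

definition structurally_well_behaved ::
  "('h, 'o, 'a, 'y) causal_model_scheme \<Rightarrow> ('l, 'p, 'b, 'z) causal_model_scheme \<Rightarrow>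
   ('h list, 'h diagram set, 'l list, 'l diagram set) monoidal_functor \<Rightarrow> bool" where
  "structurally_well_behaved H L F \<longleftrightarrow>
     (\<forall>X \<in> noninputs H. is_normalised_network L (FArr F (cls H (Box X)))) \<and>
     (\<forall>X \<in> verts H. distinct (var_image F X) \<and> set (var_image F X) \<subseteq> verts L) \<and>
     (\<forall>X \<in> verts H. \<forall>Y \<in> verts H. X \<noteq> Y \<longrightarrow> set (var_image F X) \<inter> set (var_image F Y) = {}) \<and>
     image_onto F (inputs H) (inputs L) \<and>
     image_into F (outputs H) (outputs L) \<and>
     (\<forall>X \<in> verts H. \<forall>Y \<in> verts H. X \<noteq> Y \<longrightarrow>
        mech_vars H L (\<lambda>X. set (var_image F X)) X \<inter> mech_vars H L (\<lambda>X. set (var_image F X)) Y = {})"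

end

theory Submission
  imports Defs "HOL-Library.Multiset"
begin

text \<open>
  Call a box of a string diagram live if some output depends on it. The multiset of live boxes is
  invariant under the Markov category axioms, and every diagram is equal to one whose boxes are all
  live, so isomorphisms contain no boxes. As every non-input variable of \<open>H\<close> is an output, each box
  \<open>c\<^sub>X\<close> of \<open>D\<^sub>H\<close> is connected directly to an output, and hence the multiset of live boxes of
  \<open>\<pi>(D\<^sub>H)\<close> is the sum of those of the \<open>\<pi>(c\<^sub>X)\<close>. For a normalised network \<open>\<pi>(c\<^sub>X)\<close> the boxes are
  exactly the variables in \<open>M(X)\<close>: a path to \<open>\<pi>(X)\<close> that avoids \<open>\<pi>(Pa(X))\<close> is a path of wires of the
  diagram. So both the network condition on \<open>\<pi>(D\<^sub>H)\<close> and the disjointness of the \<open>M(X)\<close> say that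
  no label occurs twice among these boxes.
\<close>


section \<open>Masks and live boxes\<close>

text \<open>Equality of string diagrams is a generated congruence, so a statement about an arrow
  needs a quantity that every axiom preserves. The boxes of a diagram are no such quantity, because
  discarding the output of a box removes the box. Every representative of an arrow contains at least
  the live boxes and some representative contains no others; if any representative is a network, so
  is this one. The sum formula for \<pi>(D_H) is proved as two inclusions, and each implication of
  the theorem uses one of them. "At most the sum" holds for every diagram and every mask and yields
  the network. "At least the sum" yields the converse and is the delicate one: \<pi>(c_X) may ignore
  inputs, so a box of D_H that reaches the outputs only through other boxes might lose its image.
  Tracing outputs back through copies alone avoids this, which is the reason for the flag
  \<open>e\<close>.\<close>

text \<open>
  A mask marks the wires at the target of a diagram from which one still wants to read. \<open>pull\<close>
  transports it to the source and \<open>live\<close> collects the boxes met on the way. If \<open>e\<close> holds then marks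
  pass backwards through boxes; otherwise boxes stop them, so that only wires connected to the target
  by copy maps alone stay marked.
\<close>

primrec pull :: "bool \<Rightarrow> ('v, 'z) open_dag_scheme \<Rightarrow> 'v diagram \<Rightarrow> bool list \<Rightarrow> bool list" where
  "pull e G (Wires A) b = b"
| "pull e G (Box X) b = replicate (length (parents G X)) (e \<and> hd b)"
| "pull e G (Copies A) b = map2 (\<or>) (take (length A) b) (drop (length A) b)"
| "pull e G (Discards A) b = replicate (length A) False"
| "pull e G (Swap A B) b = drop (length B) b @ take (length B) b"
| "pull e G (s ;; t) b = pull e G s (pull e G t b)"
| "pull e G (s \<parallel> t) b = pull e G s (take (length (tgt s)) b) @ pull e G t (drop (length (tgt s)) b)"

primrec live :: "bool \<Rightarrow> ('v, 'z) open_dag_scheme \<Rightarrow> 'v diagram \<Rightarrow> bool list \<Rightarrow> 'v multiset" where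
  "live e G (Wires A) b = {#}"
| "live e G (Box X) b = (if hd b then {#X#} else {#})"
| "live e G (Copies A) b = {#}"
| "live e G (Discards A) b = {#}"
| "live e G (Swap A B) b = {#}"
| "live e G (s ;; t) b = live e G s (pull e G t b) + live e G t b"
| "live e G (s \<parallel> t) b = live e G s (take (length (tgt s)) b) + live e G t (drop (length (tgt s)) b)"

lemma length_pull [simp]:
  "wf_diag G t \<Longrightarrow> length b = length (tgt t) \<Longrightarrow> length (pull e G t b) = length (src G t)"
  by (induction t arbitrary: b) auto

lemma live_subset_boxes: "live e G t b \<subseteq># mset (boxes t)"
  by (induction t arbitrary: b) (auto intro: subset_mset.add_mono)

lemma pull_None:
  "wf_diag G t \<Longrightarrow> pull e G t (replicate (length (tgt t)) False) = replicate (length (src G t)) False"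
  by (induction t) (auto simp: replicate_add[symmetric] add.commute intro!: nth_equalityI)

lemma live_None: "wf_diag G t \<Longrightarrow> live e G t (replicate (length (tgt t)) False) = {#}"
  by (induction t) (auto simp: pull_None)

text \<open>No negation occurs in \<open>pull\<close> or \<open>live\<close>. Monotonicity is what
  allows the later bounds to work with inequalities of masks in place of equalities.\<close>

lemma mask_mono:
  assumes "wf_diag G t" "length b = length (tgt t)" "list_all2 (\<longrightarrow>) b b'"
  shows "list_all2 (\<longrightarrow>) (pull e G t b) (pull e G t b') \<and> live e G t b \<subseteq># live e G t b'"
  using assms
proof (induction t arbitrary: b b')
  case (Seq s t)
  then show ?case by (simp add: subset_mset.add_mono)
next
  case (Par s t)
  have "list_all2 (\<longrightarrow>) (take n b) (take n b')" "list_all2 (\<longrightarrow>) (drop n b) (drop n b')" for n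
    using Par.prems(3) by (auto simp: list_all2_takeI list_all2_dropI)
  then show ?case using Par
    by (simp add: subset_mset.add_mono list_all2_appendI)
next
  case (Box X)
  then show ?case by (cases b; cases b') (auto simp: list_all2_conv_all_nth)
qed (auto simp: list_all2_conv_all_nth nth_append)

lemma length_eq_addE:
  assumes "length b = m + n"
  obtains c d where "b = c @ d" "length c = m" "length d = n"
  using assms that[of "take m b" "drop m b"] by simp

text \<open>The comonoid axioms become the laws of disjunction with unit False. A diagram with empty
  target receives the empty mask, which marks nothing, so \<open>disc_natural\<close> loses no live
  box. No axiom makes copying natural with respect to boxes; otherwise one box could be traded for
  two, and only the set of live boxes would be invariant.\<close>

lemma mask_diag_eq:
  assumes "is_open_dag G" "diag_eq G s t" "length b = length (tgt s)"
  shows "pull e G s b = pull e G t b \<and> live e G s b = live e G t b"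
  using assms(2,3)
proof (induction arbitrary: b rule: diag_eq.induct)
  case (seq_cong s s' t t')
  then show ?case using diag_eq_types[OF assms(1) seq_cong.hyps(1)] diag_eq_types[OF assms(1) seq_cong.hyps(2)]
    by simp
next
  case (par_cong s s' t t')
  then show ?case using diag_eq_types[OF assms(1) par_cong.hyps(1)]
     by simp
next
  case (dsym s t)
  then show ?case using diag_eq_types[OF assms(1) dsym.hyps] by simp
next
  case (dtrans s t u)
  then show ?case using diag_eq_types[OF assms(1) dtrans.hyps(1)] by simp
next
  case (interchange s t s' t')
  then show ?case by (simp add: add_ac)
next
  case (disc_natural t)
  then show ?case using pull_None[of G t e] live_None[of G t e] by simp
next
  case (swap_natural s t)
  then show ?case by (simp add: add_ac)
next
  case (copy_append A B)
  then have "length b = length A + (length B + (length A + length B))" by simp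
  \<comment> \<open>One block for each of the four bundles of wires; the swap exchanges the two in
    the middle.\<close>
  then obtain b1 b2 b3 b4 where "b = b1 @ b2 @ b3 @ b4"
    "length b1 = length A" "length b2 = length B" "length b3 = length A" "length b4 = length B"
    by (metis length_eq_addE)
  then show ?case by simp
next
  case (copy_coassoc A)
  then have "length b = length A + (length A + length A)" by simp
  then obtain b1 b2 b3 where "b = b1 @ b2 @ b3"
    "length b1 = length A" "length b2 = length A" "length b3 = length A"
    by (metis length_eq_addE)
  then show ?case by (auto intro!: nth_equalityI)
next
  case (copy_left_counit A)
  then show ?case by (auto intro!: nth_equalityI)
next
  case (copy_right_counit A)
  then show ?case by (auto intro!: nth_equalityI)
next
  case (swap_hexagon A B C)
  then show ?case using take_add[of "length B" "length C" b] by (simp add: add_ac take_drop)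
next
  case (copy_comm A)
  then have "length (take (length A) b) = length A" "length (drop (length A) b) = length A" by auto
  then show ?case by (auto intro!: nth_equalityI)
next
  case (disc_append A B)
  then show ?case by (simp add: replicate_add)
qed (simp_all add: add_ac drop_take)


section \<open>Removing the boxes that are not live\<close>

lemmas [trans] = diag_eq.dtrans

primrec keep :: "'v list \<Rightarrow> bool list \<Rightarrow> 'v list" where
  "keep [] b = []"
| "keep (X # A) b = (if hd b then [X] else []) @ keep A (tl b)"

text \<open>Turns a mask into a morphism, so that masks can enter diagrammatic equations here and be
  sent through a functor later.\<close>

primrec proj :: "'v list \<Rightarrow> bool list \<Rightarrow> 'v diagram" where
  "proj [] b = Wires []"
| "proj (X # A) b = (if hd b then Wires [X] else Discards [X]) \<parallel> proj A (tl b)"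

lemma set_keep: "set (keep A b) \<subseteq> set A"
  by (induction A arbitrary: b) auto

lemma keep_append [simp]: "length b = length A \<Longrightarrow> keep (A @ B) (b @ b') = keep A b @ keep B b'"
  by (induction A b rule: list_induct2') auto

lemma keep_all [simp]: "keep A (replicate (length A) True) = A"
  by (induction A) auto

lemma keep_none [simp]: "keep A (replicate (length A) False) = []"
  by (induction A) auto

lemma proj_simps [simp]: "src G (proj A b) = A" "tgt (proj A b) = keep A b" "boxes (proj A b) = []"
  "wf_diag G (proj A b) \<longleftrightarrow> set A \<subseteq> verts G"
  by (induction A arbitrary: b) auto

lemma proj_append:
  assumes "length b = length A" "set A \<subseteq> verts G" "set B \<subseteq> verts G"
  shows "diag_eq G (proj (A @ B) (b @ b')) (proj A b \<parallel> proj B b')"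
  using assms
proof (induction A b rule: list_induct2')
  case 1
  then show ?case by (auto intro!: diag_eq.dsym[OF diag_eq.unit_par])
next
  case (4 X A c b)
  let ?p = "if c then Wires [X] else Discards [X]"
  have "diag_eq G (?p \<parallel> proj (A @ B) (b @ b')) (?p \<parallel> (proj A b \<parallel> proj B b'))"
    using 4 by (intro diag_eq.par_cong diag_eq.drefl) auto
  also have "diag_eq G \<dots> ((?p \<parallel> proj A b) \<parallel> proj B b')"
    using 4 by (intro diag_eq.dsym[OF diag_eq.par_assoc]) auto
  finally show ?case by simp
qed auto

lemma proj_all: "set A \<subseteq> verts G \<Longrightarrow> diag_eq G (proj A (replicate (length A) True)) (Wires A)"
proof (induction A)
  case (Cons X A)
  then have "diag_eq G (Wires [X] \<parallel> proj A (replicate (length A) True)) (Wires [X] \<parallel> Wires A)"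
    by (intro diag_eq.par_cong diag_eq.drefl) auto
  also have "diag_eq G \<dots> (Wires ([X] @ A))"
    using Cons.prems by (intro diag_eq.id_par_id) auto
  finally show ?case by simp
qed (auto intro: diag_eq.drefl)

lemma proj_none: "set A \<subseteq> verts G \<Longrightarrow> diag_eq G (proj A (replicate (length A) False)) (Discards A)"
  using diag_eq.disc_natural[of G "proj A (replicate (length A) False)"] by simp

lemma diag_eq_empty_tgt:
  "\<lbrakk>wf_diag G s; wf_diag G t; tgt s = []; tgt t = []; src G s = src G t\<rbrakk> \<Longrightarrow> diag_eq G s t"
  by (metis diag_eq.disc_natural diag_eq.dsym diag_eq.dtrans)

text \<open>Either both copies stay, or a counit law removes one of them, or both sides end in the
  terminal object. Accordingly \<open>u\<close> is a copy, a wire or empty.\<close>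

lemma copies_proj_wire:
  assumes "X \<in> verts G"
  shows "\<exists>u. wf_diag G u \<and> src G u = keep [X] [c \<or> c'] \<and> tgt u = keep [X] [c] @ keep [X] [c'] \<and> boxes u = [] \<and>
    diag_eq G (Copies [X] ;; ((if c then Wires [X] else Discards [X]) \<parallel> (if c' then Wires [X] else Discards [X])))
      ((if c \<or> c' then Wires [X] else Discards [X]) ;; u)" (is "\<exists>u. ?P u")
proof -
  have i: "diag_eq G (Wires [X]) (Wires [X] ;; Wires [X])"
    using assms diag_eq.dsym[OF diag_eq.id_seq[of G "Wires [X]"]] by simp
  consider "c" "c'" | "c" "\<not> c'" | "\<not> c" "c'" | "\<not> c" "\<not> c'" by blast
  then show ?thesis
  proof cases
    case 1
    have "diag_eq G (Wires [X] \<parallel> Wires [X]) (Wires ([X] @ [X]))"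
      using assms by (intro diag_eq.id_par_id) simp
    then have "diag_eq G (Copies [X] ;; (Wires [X] \<parallel> Wires [X])) (Copies [X] ;; Wires ([X] @ [X]))"
      using assms by (intro diag_eq.seq_cong diag_eq.drefl) auto
    also have "diag_eq G \<dots> (Copies [X])"
      using assms diag_eq.seq_id[of G "Copies [X]"] by simp
    also have "diag_eq G \<dots> (Wires [X] ;; Copies [X])"
      using assms diag_eq.dsym[OF diag_eq.id_seq[of G "Copies [X]"]] by simp
    finally have "?P (Copies [X])" using 1 assms by simp
    then show ?thesis by blast
  next
    case 2
    have "?P (Wires [X])" using 2 assms i diag_eq.copy_right_counit[of G "[X]"]
      by (auto intro: diag_eq.dtrans)
    then show ?thesis by blast
  next
    case 3
    have "?P (Wires [X])" using 3 assms i diag_eq.copy_left_counit[of G "[X]"]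
      by (auto intro: diag_eq.dtrans)
    then show ?thesis by blast
  next
    case 4
    have "?P (Wires [])" using 4 assms by (auto intro: diag_eq_empty_tgt)
    then show ?thesis by blast
  qed
qed

text \<open>Naturality of the middle exchange, needed to move the swap of \<open>copy_append\<close>
  past projections. Reassociation isolates the pair \<open>q\<close>, \<open>r\<close> that the swap
  crosses.\<close>

lemma swap_past:
  assumes "wf_diag G p" "wf_diag G q" "wf_diag G r" "wf_diag G s"
    "set (src G q) \<subseteq> verts G" "set (src G r) \<subseteq> verts G"
    "set (tgt q) \<subseteq> verts G" "set (tgt r) \<subseteq> verts G"
    "set (tgt p) \<subseteq> verts G" "set (tgt s) \<subseteq> verts G"
    "set (src G p) \<subseteq> verts G" "set (src G s) \<subseteq> verts G"
  shows "diag_eq G ((Wires (src G p) \<parallel> Swap (src G q) (src G r) \<parallel> Wires (src G s)) ;; ((p \<parallel> r) \<parallel> (q \<parallel> s)))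
    (((p \<parallel> q) \<parallel> (r \<parallel> s)) ;; (Wires (tgt p) \<parallel> Swap (tgt q) (tgt r) \<parallel> Wires (tgt s)))"
proof -
  have reassoc: "diag_eq G ((a \<parallel> b) \<parallel> (c \<parallel> d)) (a \<parallel> (b \<parallel> c) \<parallel> d)"
    if "wf_diag G a" "wf_diag G b" "wf_diag G c" "wf_diag G d" for a b c d :: "'a diagram"
  proof -
    have "diag_eq G ((a \<parallel> b) \<parallel> (c \<parallel> d)) (a \<parallel> (b \<parallel> (c \<parallel> d)))"
      using that by (intro diag_eq.par_assoc) simp
    also have "diag_eq G \<dots> (a \<parallel> (b \<parallel> c) \<parallel> d)"
      using that by (intro diag_eq.par_cong diag_eq.drefl diag_eq.dsym[OF diag_eq.par_assoc]) auto
    finally show ?thesis .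
  qed
  let ?W = Wires
  have "diag_eq G ((?W (src G p) \<parallel> Swap (src G q) (src G r) \<parallel> ?W (src G s)) ;; ((p \<parallel> r) \<parallel> (q \<parallel> s)))
    ((?W (src G p) \<parallel> Swap (src G q) (src G r) \<parallel> ?W (src G s)) ;; (p \<parallel> (r \<parallel> q) \<parallel> s))"
    using assms by (intro diag_eq.drefl diag_eq.seq_cong reassoc) auto
  also have "diag_eq G \<dots>
     ((?W (src G p) ;; p) \<parallel> ((Swap (src G q) (src G r) \<parallel> ?W (src G s)) ;; ((r \<parallel> q) \<parallel> s)))"
    using assms by (intro diag_eq.dsym[OF diag_eq.interchange]) auto
  also have "diag_eq G \<dots>
     ((?W (src G p) ;; p) \<parallel> ((Swap (src G q) (src G r) ;; (r \<parallel> q)) \<parallel> (?W (src G s) ;; s)))"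
    using assms by (intro diag_eq.drefl diag_eq.par_cong diag_eq.dsym[OF diag_eq.interchange]) auto
  also have "diag_eq G \<dots>
     ((p ;; ?W (tgt p)) \<parallel> (((q \<parallel> r) ;; Swap (tgt q) (tgt r)) \<parallel> (s ;; ?W (tgt s))))"
    using assms by (intro diag_eq.par_cong diag_eq.dtrans[OF diag_eq.id_seq diag_eq.dsym[OF diag_eq.seq_id]]
      diag_eq.dsym[OF diag_eq.swap_natural]) auto
  also have "diag_eq G \<dots>
     ((p ;; ?W (tgt p)) \<parallel> (((q \<parallel> r) \<parallel> s) ;; (Swap (tgt q) (tgt r) \<parallel> ?W (tgt s))))"
    using assms by (intro diag_eq.drefl diag_eq.par_cong diag_eq.interchange) auto
  also have "diag_eq G \<dots>
     ((p \<parallel> (q \<parallel> r) \<parallel> s) ;; (?W (tgt p) \<parallel> Swap (tgt q) (tgt r) \<parallel> ?W (tgt s)))"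
    using assms by (intro diag_eq.interchange) auto
  also have "diag_eq G \<dots>
     (((p \<parallel> q) \<parallel> (r \<parallel> s)) ;; (?W (tgt p) \<parallel> Swap (tgt q) (tgt r) \<parallel> ?W (tgt s)))"
    using assms by (intro diag_eq.seq_cong diag_eq.dsym[OF reassoc] diag_eq.drefl) auto
  finally show ?thesis .
qed

text \<open>A wire is needed before a copy exactly when one of its two copies is needed after it,
  whence the disjunction. Wires are split off one at a time by \<open>copy_append\<close>.\<close>

lemma copies_proj:
  assumes "length b = length A" "length b' = length A" "set A \<subseteq> verts G"
  shows "\<exists>u. wf_diag G u \<and> src G u = keep A (map2 (\<or>) b b') \<and> tgt u = keep A b @ keep A b' \<and> boxes u = [] \<and>
    diag_eq G (Copies A ;; (proj A b \<parallel> proj A b')) (proj A (map2 (\<or>) b b') ;; u)"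
  using assms
proof (induction A arbitrary: b b')
  case Nil
  then show ?case by (intro exI[of _ "Wires []"]) (auto intro: diag_eq_empty_tgt)
next
  case (Cons X A)
  obtain c d c' d' where b: "b = c # d" "b' = c' # d'"
    using Cons.prems by (metis length_Suc_conv list.size(4) One_nat_def add.right_neutral add_Suc_right)
  let ?p = "\<lambda>c. if c then Wires [X] else Discards [X]"
  let ?k = "\<lambda>c. if c then [X] else []"
  let ?K = "keep A" and ?m = "map2 (\<or>) d d'"
  obtain v where v: "wf_diag G v" "src G v = ?k (c \<or> c')" "tgt v = ?k c @ ?k c'" "boxes v = []"
    "diag_eq G (Copies [X] ;; (?p c \<parallel> ?p c')) (?p (c \<or> c') ;; v)"
    using copies_proj_wire[of X G c c'] Cons.prems by auto
  obtain u where u: "wf_diag G u" "src G u = ?K ?m" "tgt u = ?K d @ ?K d'" "boxes u = []"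
    "diag_eq G (Copies A ;; (proj A d \<parallel> proj A d')) (proj A ?m ;; u)"
    using Cons.IH[of d d'] Cons.prems b by auto
  let ?R = "Wires (?k c) \<parallel> Swap (?k c') (?K d) \<parallel> Wires (?K d')"
  have X: "X \<in> verts G" "set A \<subseteq> verts G" using Cons.prems by auto
  note sub = subset_trans[OF set_keep X(2)]
  have "diag_eq G (Copies ([X] @ A) ;; ((?p c \<parallel> proj A d) \<parallel> (?p c' \<parallel> proj A d')))
    (((Copies [X] \<parallel> Copies A) ;; (Wires [X] \<parallel> Swap [X] A \<parallel> Wires A)) ;; ((?p c \<parallel> proj A d) \<parallel> (?p c' \<parallel> proj A d')))"
    using X by (intro diag_eq.seq_cong diag_eq.drefl diag_eq.copy_append) auto
  also have "diag_eq G \<dots>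
    ((Copies [X] \<parallel> Copies A) ;; ((Wires [X] \<parallel> Swap [X] A \<parallel> Wires A) ;; ((?p c \<parallel> proj A d) \<parallel> (?p c' \<parallel> proj A d'))))"
    using X by (intro diag_eq.seq_assoc) auto
  also have "diag_eq G \<dots>
    ((Copies [X] \<parallel> Copies A) ;; (((?p c \<parallel> ?p c') \<parallel> (proj A d \<parallel> proj A d')) ;; ?R))"
    using X sub swap_past[of G "?p c" "?p c'" "proj A d" "proj A d'"]
    by (intro diag_eq.seq_cong[OF diag_eq.drefl]) (auto split: if_splits)
  also have "diag_eq G \<dots>
    (((Copies [X] \<parallel> Copies A) ;; ((?p c \<parallel> ?p c') \<parallel> (proj A d \<parallel> proj A d'))) ;; ?R)"
    using X sub by (intro diag_eq.dsym[OF diag_eq.seq_assoc]) auto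
  also have "diag_eq G \<dots>
    (((Copies [X] ;; (?p c \<parallel> ?p c')) \<parallel> (Copies A ;; (proj A d \<parallel> proj A d'))) ;; ?R)"
    using X sub by (intro diag_eq.seq_cong diag_eq.drefl diag_eq.dsym[OF diag_eq.interchange]) auto
  also have "diag_eq G \<dots> (((?p (c \<or> c') ;; v) \<parallel> (proj A ?m ;; u)) ;; ?R)"
    using X sub u v by (intro diag_eq.seq_cong[OF diag_eq.par_cong[OF v(5) u(5)] diag_eq.drefl]) auto
  also have "diag_eq G \<dots> (((?p (c \<or> c') \<parallel> proj A ?m) ;; (v \<parallel> u)) ;; ?R)"
    using X sub u v by (intro diag_eq.seq_cong diag_eq.interchange diag_eq.drefl) auto
  also have "diag_eq G \<dots> ((?p (c \<or> c') \<parallel> proj A ?m) ;; ((v \<parallel> u) ;; ?R))"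
    using X sub u v by (intro diag_eq.seq_assoc) auto
  finally show ?case
    using b u v X sub by (intro exI[of _ "(v \<parallel> u) ;; ?R"]) auto
qed

text \<open>Discarding the unmarked outputs can be pushed backwards through the diagram, and every
  box that it meets vanishes by \<open>disc_natural\<close>; \<open>u\<close> is what remains.
  Arbitrary masks are needed in the induction, since the first factor of a composite sees only the
  mask pulled back through the second.\<close>

theorem normal_form:
  assumes "is_open_dag G" "wf_diag G t" "length b = length (tgt t)"
  shows "\<exists>u. wf_diag G u \<and> src G u = keep (src G t) (pull True G t b) \<and> tgt u = keep (tgt t) b \<and>
    mset (boxes u) = live True G t b \<and>
    diag_eq G (t ;; proj (tgt t) b) (proj (src G t) (pull True G t b) ;; u)"
  using assms(2,3)
proof (induction t arbitrary: b)
  case (Wires A)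
  then show ?case
    using diag_eq.id_seq[of G "proj A b"] diag_eq.seq_id[of G "proj A b"] subset_trans[OF set_keep, of A "verts G" b]
    by (intro exI[of _ "Wires (keep A b)"]) (auto intro: diag_eq.dtrans diag_eq.dsym)
next
  case (Box X)
  then have X: "X \<in> verts G" and pa: "set (parents G X) \<subseteq> verts G"
    using assms(1) by (auto simp: noninputs_def is_open_dag_def)
  obtain c where b: "b = [c]" using Box.prems by (auto simp: length_Suc_conv)
  show ?case
  proof (cases c)
    case True
    have "diag_eq G (Box X ;; proj [X] [True]) (Box X ;; Wires [X])"
      using proj_all[of "[X]" G] X Box.prems by (intro diag_eq.seq_cong diag_eq.drefl) auto
    also have "diag_eq G \<dots> (Box X)"
      using Box.prems diag_eq.seq_id[of G "Box X"] by simp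
    also have "diag_eq G \<dots> (Wires (parents G X) ;; Box X)"
      using Box.prems diag_eq.dsym[OF diag_eq.id_seq[of G "Box X"]] by simp
    also have "diag_eq G \<dots> (proj (parents G X) (replicate (length (parents G X)) True) ;; Box X)"
      using proj_all[OF pa] Box.prems by (intro diag_eq.seq_cong diag_eq.drefl) (auto intro: diag_eq.dsym)
    finally show ?thesis
      using b True Box.prems by (intro exI[of _ "Box X"]) auto
  next
    \<comment> \<open>The discard absorbs the box: both sides have empty target and agree by
      terminality.\<close>
    case False
    then show ?thesis using b X pa Box.prems
      by (intro exI[of _ "Wires []"]) (auto intro!: diag_eq_empty_tgt)
  qed
next
  case (Copies A)
  define d d' where "d = take (length A) b" and "d' = drop (length A) b"
  have d: "b = d @ d'" "length d = length A" "length d' = length A"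
    using Copies.prems by (auto simp: d_def d'_def)
  obtain u where u: "wf_diag G u" "src G u = keep A (map2 (\<or>) d d')" "tgt u = keep A d @ keep A d'" "boxes u = []"
    "diag_eq G (Copies A ;; (proj A d \<parallel> proj A d')) (proj A (map2 (\<or>) d d') ;; u)"
    using copies_proj[OF d(2,3), of G] Copies.prems by auto
  have "diag_eq G (Copies A ;; proj (A @ A) b) (Copies A ;; (proj A d \<parallel> proj A d'))"
    using Copies.prems d proj_append[OF d(2), of G A d'] by (intro diag_eq.seq_cong diag_eq.drefl) auto
  also note u(5)
  finally show ?case
    using u d by (intro exI[of _ u]) auto
next
  case (Discards A)
  then show ?case by (intro exI[of _ "Wires []"]) (auto intro!: diag_eq_empty_tgt)
next
  case (Swap A B)
  define d d' where "d = take (length B) b" and "d' = drop (length B) b"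
  have d: "b = d @ d'" "length d = length B" "length d' = length A"
    using Swap.prems by (auto simp: d_def d'_def)
  have sub: "set A \<subseteq> verts G" "set B \<subseteq> verts G" "set (keep A d') \<subseteq> verts G" "set (keep B d) \<subseteq> verts G"
    using Swap.prems set_keep by fastforce+
  have "diag_eq G (Swap A B ;; proj (B @ A) b) (Swap A B ;; (proj B d \<parallel> proj A d'))"
    using sub d proj_append[OF d(2), of G A d'] by (intro diag_eq.seq_cong diag_eq.drefl) auto
  also have "diag_eq G \<dots> ((proj A d' \<parallel> proj B d) ;; Swap (keep A d') (keep B d))"
    using sub diag_eq.dsym[OF diag_eq.swap_natural[of G "proj A d'" "proj B d"]] by simp
  also have "diag_eq G \<dots> (proj (A @ B) (d' @ d) ;; Swap (keep A d') (keep B d))"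
    using sub d diag_eq.dsym[OF proj_append[OF d(3), of G B d]]
    by (intro diag_eq.seq_cong diag_eq.drefl) auto
  finally show ?case
    using sub d by (intro exI[of _ "Swap (keep A d') (keep B d)"]) auto
next
  case (Seq s t)
  let ?c = "pull True G t b"
  let ?a = "pull True G s ?c"
  have wf: "wf_diag G s" "wf_diag G t" "tgt s = src G t" "set (src G s) \<subseteq> verts G"
      "set (tgt s) \<subseteq> verts G" "set (tgt t) \<subseteq> verts G"
    using Seq.prems wf_diag_verts[OF assms(1)] by auto
  obtain u where u: "wf_diag G u" "src G u = keep (src G t) ?c" "tgt u = keep (tgt t) b"
    "mset (boxes u) = live True G t b" "diag_eq G (t ;; proj (tgt t) b) (proj (src G t) ?c ;; u)"
    using Seq.IH(2)[of b] Seq.prems by auto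
  obtain v where v: "wf_diag G v" "src G v = keep (src G s) ?a" "tgt v = keep (tgt s) ?c"
    "mset (boxes v) = live True G s ?c" "diag_eq G (s ;; proj (tgt s) ?c) (proj (src G s) ?a ;; v)"
    using Seq.IH(1)[of ?c] Seq.prems by auto
  have "diag_eq G (s ;; t ;; proj (tgt t) b) (s ;; (t ;; proj (tgt t) b))"
    using wf by (intro diag_eq.seq_assoc) auto
  also have "diag_eq G \<dots> (s ;; (proj (src G t) ?c ;; u))"
    using wf u by (intro diag_eq.seq_cong[OF diag_eq.drefl]) auto
  also have "diag_eq G \<dots> (s ;; proj (src G t) ?c ;; u)"
    using wf u by (intro diag_eq.dsym[OF diag_eq.seq_assoc]) auto
  also have "diag_eq G \<dots> (proj (src G s) ?a ;; v ;; u)"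
    using wf u v by (intro diag_eq.seq_cong[OF v(5)[unfolded wf(3)] diag_eq.drefl]) auto
  also have "diag_eq G \<dots> (proj (src G s) ?a ;; (v ;; u))"
    using wf u v by (intro diag_eq.seq_assoc) auto
  finally show ?case
    using wf u v by (intro exI[of _ "v ;; u"]) auto
next
  case (Par s t)
  define d d' where "d = take (length (tgt s)) b" and "d' = drop (length (tgt s)) b"
  have d: "b = d @ d'" "length d = length (tgt s)" "length d' = length (tgt t)"
    using Par.prems by (auto simp: d_def d'_def)
  let ?a = "pull True G s d" and ?a' = "pull True G t d'"
  have wf: "wf_diag G s" "wf_diag G t" "set (src G s) \<subseteq> verts G" "set (src G t) \<subseteq> verts G"
      "set (tgt s) \<subseteq> verts G" "set (tgt t) \<subseteq> verts G"
    using Par.prems wf_diag_verts[OF assms(1)] by auto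
  have len: "length ?a = length (src G s)" using wf d by simp
  obtain v where v: "wf_diag G v" "src G v = keep (src G s) ?a" "tgt v = keep (tgt s) d"
    "mset (boxes v) = live True G s d" "diag_eq G (s ;; proj (tgt s) d) (proj (src G s) ?a ;; v)"
    using Par.IH(1)[of d] wf d by auto
  obtain u where u: "wf_diag G u" "src G u = keep (src G t) ?a'" "tgt u = keep (tgt t) d'"
    "mset (boxes u) = live True G t d'" "diag_eq G (t ;; proj (tgt t) d') (proj (src G t) ?a' ;; u)"
    using Par.IH(2)[of d'] wf d by auto
  have "diag_eq G ((s \<parallel> t) ;; proj (tgt s @ tgt t) b) ((s \<parallel> t) ;; (proj (tgt s) d \<parallel> proj (tgt t) d'))"
    using wf d proj_append[OF d(2), of G "tgt t" d'] by (intro diag_eq.seq_cong diag_eq.drefl) auto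
  also have "diag_eq G \<dots> ((s ;; proj (tgt s) d) \<parallel> (t ;; proj (tgt t) d'))"
    using wf by (intro diag_eq.dsym[OF diag_eq.interchange]) auto
  also have "diag_eq G \<dots> ((proj (src G s) ?a ;; v) \<parallel> (proj (src G t) ?a' ;; u))"
    using u v by (intro diag_eq.par_cong)
  also have "diag_eq G \<dots> ((proj (src G s) ?a \<parallel> proj (src G t) ?a') ;; (v \<parallel> u))"
    using wf u v by (intro diag_eq.interchange) auto
  also have "diag_eq G \<dots> (proj (src G s @ src G t) (?a @ ?a') ;; (v \<parallel> u))"
    using wf u v len diag_eq.dsym[OF proj_append[OF len, of G "src G t" ?a']]
    by (intro diag_eq.seq_cong diag_eq.drefl) auto
  finally show ?case
    using wf d u v len by (intro exI[of _ "v \<parallel> u"]) auto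
qed


section \<open>Masks on the free Markov category\<close>

abbreviation all_true :: "'a list \<Rightarrow> bool list" where
  "all_true A \<equiv> replicate (length A) True"

text \<open>By \<open>mask_diag_eq\<close> the choice made by \<open>rep\<close> is immaterial for
  masks of the right length. Only the flag True is transferred to arrows; the flag False will be
  applied to a given diagram of the source category.\<close>

definition pull_arr :: "('v, 'z) open_dag_scheme \<Rightarrow> 'v diagram set \<Rightarrow> bool list \<Rightarrow> bool list" where
  "pull_arr G f = pull True G (rep f)"

definition live_arr :: "('v, 'z) open_dag_scheme \<Rightarrow> 'v diagram set \<Rightarrow> bool list \<Rightarrow> 'v multiset" where
  "live_arr G f = live True G (rep f)"

lemma tgt_subset: "wf_diag G t \<Longrightarrow> set (tgt t) \<subseteq> set (src G t) \<union> set (boxes t)"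
  by (induction t) auto

lemma parents_subset:
  "wf_diag G t \<Longrightarrow> X \<in> set (boxes t) \<Longrightarrow> set (parents G X) \<subseteq> set (src G t) \<union> set (boxes t)"
  using tgt_subset by (induction t) fastforce+

lemma list_all2_imp_all_true:
  "list_all2 (\<longrightarrow>) (replicate n True) b \<longleftrightarrow> b = replicate n True"
  by (auto simp: list_all2_conv_all_nth intro: nth_equalityI)

lemma list_all2_imp_below: "length b = n \<Longrightarrow> list_all2 (\<longrightarrow>) b (replicate n True)"
  by (auto simp: list_all2_conv_all_nth)

locale dag =
  fixes G :: "('v, 'z) open_dag_scheme"
  assumes G: "is_open_dag G"
begin

abbreviation "M \<equiv> free_markov G"
abbreviation "\<p> \<equiv> pull_arr G"
abbreviation "\<l> \<equiv> live_arr G"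

lemma mask_cls:
  assumes "wf_diag G t" "length b = length (tgt t)"
  shows "\<p> (cls G t) b = pull True G t b" "\<l> (cls G t) b = live True G t b"
  using mask_diag_eq[OF G diag_eq_rep[OF assms(1)] assms(2), of True]
  by (simp_all add: pull_arr_def live_arr_def)

lemma Hom_E:
  assumes "f \<in> Hom M A B"
  obtains t where "f = cls G t" "wf_diag G t" "src G t = A" "tgt t = B"
  using assms by (auto simp: free_Hom[OF G])

lemma cls_Hom [intro]: "wf_diag G t \<Longrightarrow> src G t = A \<Longrightarrow> tgt t = B \<Longrightarrow> cls G t \<in> Hom M A B"
  by (auto simp: free_Hom[OF G])

lemma length_pull_arr [simp]:
  "f \<in> Hom M A B \<Longrightarrow> length b = length B \<Longrightarrow> length (\<p> f b) = length A"
  by (auto elim!: Hom_E simp: mask_cls)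

lemma mask_Cmp:
  assumes "f \<in> Hom M A B" "g \<in> Hom M B D" "length b = length D"
  shows "\<p> (f \<Zsemi>\<^bsub>M\<^esub> g) b = \<p> f (\<p> g b)"
    and "\<l> (f \<Zsemi>\<^bsub>M\<^esub> g) b = \<l> f (\<p> g b) + \<l> g b"
  using assms G by (auto elim!: Hom_E simp: mask_cls)

lemma mask_TenA:
  assumes "f \<in> Hom M A B" "g \<in> Hom M A' B'" "length b = length B" "length b' = length B'"
  shows "\<p> (f \<otimes>\<^bsub>M\<^esub> g) (b @ b') = \<p> f b @ \<p> g b'"
    and "\<l> (f \<otimes>\<^bsub>M\<^esub> g) (b @ b') = \<l> f b + \<l> g b'"
  using assms G by (auto elim!: Hom_E simp: mask_cls)

lemma mask_arr_mono:
  assumes "f \<in> Hom M A B" "length b = length B" "list_all2 (\<longrightarrow>) b b'"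
  shows "list_all2 (\<longrightarrow>) (\<p> f b) (\<p> f b')" "\<l> f b \<subseteq># \<l> f b'"
  using assms mask_mono[of G _ b b' True] list_all2_lengthD[OF assms(3)]
  by (auto elim!: Hom_E simp: mask_cls)

text \<open>The normal form for the full mask. The projection in front of \<open>u\<close> has no
  boxes, so those of \<open>u\<close> are all there are. By \<open>live_subset_boxes\<close> no
  representative has fewer.\<close>

lemma live_rep:
  assumes "f \<in> Hom M A B"
  obtains t where "wf_diag G t" "src G t = A" "tgt t = B" "f = cls G t" "mset (boxes t) = \<l> f (all_true B)"
proof -
  obtain s where s: "f = cls G s" "wf_diag G s" "src G s = A" "tgt s = B" using assms by (rule Hom_E)
  obtain u where u: "wf_diag G u" "src G u = keep A (pull True G s (all_true B))" "tgt u = B"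
    "mset (boxes u) = live True G s (all_true B)"
    "diag_eq G (s ;; proj B (all_true B)) (proj A (pull True G s (all_true B)) ;; u)"
    using normal_form[OF G s(2), of "all_true B"] s by auto
  have sub: "set A \<subseteq> verts G" "set B \<subseteq> verts G" using wf_diag_verts[OF G s(2)] s by auto
  have "diag_eq G s (s ;; Wires (tgt s))" using s(2) by (rule diag_eq.dsym[OF diag_eq.seq_id])
  also have "diag_eq G \<dots> (s ;; proj (tgt s) (all_true (tgt s)))"
    using s sub diag_eq.dsym[OF proj_all[OF sub(2)]] by (intro diag_eq.seq_cong[OF diag_eq.drefl]) auto
  also have "diag_eq G \<dots> (proj A (pull True G s (all_true B)) ;; u)" using u(5) s(4) by simp
  finally have "f = cls G (proj A (pull True G s (all_true B)) ;; u)"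
    using s(1) cls_eqI by blast
  moreover have "mset (boxes (proj A (pull True G s (all_true B)) ;; u)) = \<l> f (all_true B)"
    using u(4) s by (simp add: mask_cls)
  ultimately show ?thesis
    using u s sub by (intro that[of "proj A (pull True G s (all_true B)) ;; u"]) simp_all
qed

text \<open>In contrast to \<open>inverse_arrs\<close>, both objects are named and the arrows play
  symmetric roles, so each fact about \<open>f\<close> gives one about \<open>g\<close>.\<close>

definition inverses :: "'v list \<Rightarrow> 'v list \<Rightarrow> 'v diagram set \<Rightarrow> 'v diagram set \<Rightarrow> bool" where
  "inverses A B f g \<longleftrightarrow> f \<in> Hom M A B \<and> g \<in> Hom M B A \<and>
     f \<Zsemi>\<^bsub>M\<^esub> g = Ide M A \<and> g \<Zsemi>\<^bsub>M\<^esub> f = Ide M B"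

lemma inverses_sym: "inverses A B f g \<Longrightarrow> inverses B A g f"
  by (auto simp: inverses_def)

lemma iso_inverses:
  assumes "iso_arr M f" "f \<in> Hom M A B"
  obtains g where "inverses A B f g"
  using assms by (auto simp: iso_arr_def inverse_arrs_def inverses_def Hom_def)

context
  fixes A B f g assumes fg: "inverses A B f g"
begin

lemma inverses_verts: "set A \<subseteq> verts G"
  using fg wf_diag_verts[OF G] by (auto simp: inverses_def elim!: Hom_E)

text \<open>Pulling back is contravariant and identities have no live boxes; a sum of multisets is
  empty only if both summands are.\<close>

lemma mask_inverse:
  assumes "length a = length A"
  shows "\<p> f (\<p> g a) = a" "\<l> f (\<p> g a) = {#}"
proof -
  have "\<p> (Ide M A) a = a" "\<l> (Ide M A) a = {#}"
    using assms inverses_verts by (auto simp: mask_cls)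
  then show "\<p> f (\<p> g a) = a" "\<l> f (\<p> g a) = {#}"
    using fg mask_Cmp[of f A B g A a] assms by (auto simp: inverses_def)
qed

end

text \<open>The masks \<open>\<p> g a\<close> exhaust all masks on \<open>B\<close>, so the absence
  of live boxes in \<open>mask_inverse\<close> extends to every \<open>b\<close>.\<close>

lemma iso_mask:
  assumes "inverses A B f g" "length b = length B"
  shows "\<l> f b = {#}" "\<p> g (\<p> f b) = b"
  using mask_inverse[OF inverses_sym[OF assms(1)] assms(2)] mask_inverse(2)[OF assms(1), of "\<p> f b"] assms
  by (auto simp: inverses_def)

text \<open>Pulling back along the inverse is monotone as well. This lets an inequality of masks on
  the image of a concatenation be checked on the two blocks.\<close>

lemma iso_reflects:
  assumes "inverses A B f g" "length b = length B" "length b' = length B"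
    "list_all2 (\<longrightarrow>) (\<p> f b) (\<p> f b')"
  shows "list_all2 (\<longrightarrow>) b b'"
proof -
  have "list_all2 (\<longrightarrow>) (\<p> g (\<p> f b)) (\<p> g (\<p> f b'))"
    using assms by (intro mask_arr_mono(1)[of g B A]) (auto simp: inverses_def)
  then show ?thesis using iso_mask(2)[OF assms(1)] assms(2,3) by simp
qed

text \<open>An order isomorphism preserves the greatest element.\<close>

lemma iso_all_true:
  assumes "inverses A B f g"
  shows "\<p> f (all_true B) = all_true A"
proof -
  note h = assms[unfolded inverses_def]
  have "list_all2 (\<longrightarrow>) (\<p> f (\<p> g (all_true A))) (\<p> f (all_true B))"
    using h by (intro mask_arr_mono(1)[of f A B] list_all2_imp_below) auto
  then show ?thesis
    using mask_inverse(1)[OF assms] by (simp add: list_all2_imp_all_true)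
qed

text \<open>An isomorphism from \<open>A\<close> to \<open>B\<close> permutes masks, so there are equally many on both sides.\<close>

lemma iso_length:
  assumes "inverses A B f g"
  shows "length A = length B"
proof -
  note h = assms[unfolded inverses_def]
  let ?S = "\<lambda>n. {b :: bool list. set b \<subseteq> UNIV \<and> length b = n}"
  have "bij_betw (\<p> f) (?S (length B)) (?S (length A))"
    using h iso_mask(2)[OF assms] iso_mask(2)[OF inverses_sym[OF assms]]
    by (intro bij_betw_byWitness[where f' = "\<p> g"]) auto
  then have "card (?S (length B)) = card (?S (length A))" by (rule bij_betw_same_card)
  then show ?thesis
    using card_lists_length_eq[of "UNIV :: bool set"] by simp
qed

text \<open>Without live boxes there is a representative without boxes, and its outputs can only
  carry labels of inputs.\<close>

lemma iso_set:
  assumes "inverses A B f g"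
  shows "set A = set B"
proof -
  have sub: "set B \<subseteq> set A" if fg: "inverses A B f g" for A B f g
  proof -
    have "f \<in> Hom M A B" using fg by (simp add: inverses_def)
    then obtain t where t: "wf_diag G t" "src G t = A" "tgt t = B" "mset (boxes t) = \<l> f (all_true B)"
      by (rule live_rep)
    then have "boxes t = []" using iso_mask(1)[OF fg, of "all_true B"] by simp
    then show ?thesis using tgt_subset[OF t(1)] t by simp
  qed
  show ?thesis using sub[OF assms] sub[OF inverses_sym[OF assms]] by blast
qed

end


section \<open>Masks under a cd-functor\<close>

locale dag_functor = H: dag H + L: dag L + F: cd_functor "free_markov H" "free_markov L" F
  for H :: "('h, 'y) open_dag_scheme" and L :: "('l, 'z) open_dag_scheme"
    and F :: "('h list, 'h diagram set, 'l list, 'l diagram set) monoidal_functor"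
begin

abbreviation "\<phi> t \<equiv> FArr F (cls H t)"
abbreviation "\<p> \<equiv> pull_arr L"
abbreviation "\<l> \<equiv> live_arr L"

lemma \<phi>_Hom: "wf_diag H t \<Longrightarrow> A = FObj F (src H t) \<Longrightarrow> B = FObj F (tgt t) \<Longrightarrow> \<phi> t \<in> Hom L.M A B"
  by (auto intro!: F.FArr_Hom)

lemma \<phi>_cong: "diag_eq H s t \<Longrightarrow> \<phi> s = \<phi> t"
  by (metis cls_eqI)

lemma FObj_verts: "set A \<subseteq> verts H \<Longrightarrow> set (FObj F A) \<subseteq> verts L"
  using F.FObj_Obj[of A] by (auto simp: in_lists_conv_set)

lemma \<phi>_Wires: "set A \<subseteq> verts H \<Longrightarrow> \<phi> (Wires A) = cls L (Wires (FObj F A))"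
  using F.FArr_Ide[of A] by auto

lemma \<phi>_Seq:
  "wf_diag H s \<Longrightarrow> wf_diag H t \<Longrightarrow> tgt s = src H t \<Longrightarrow> \<phi> (s ;; t) = \<phi> s \<Zsemi>\<^bsub>L.M\<^esub> \<phi> t"
  using F.FArr_Cmp[of "cls H s" "src H s" "tgt s" "cls H t" "tgt t"] H.G by auto

lemma Mu_inverses:
  assumes "set A \<subseteq> verts H" "set B \<subseteq> verts H"
  obtains g where "L.inverses (FObj F A @ FObj F B) (FObj F (A @ B)) (Mu F A B) g"
proof -
  have "A \<in> Obj H.M" "B \<in> Obj H.M" using assms by auto
  then have "iso_arr L.M (Mu F A B)" "Mu F A B \<in> Hom L.M (FObj F A @ FObj F B) (FObj F (A @ B))"
    using F.Mu_iso[of A B] F.Mu_Hom[of A B] by auto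
  then show ?thesis using L.iso_inverses that by blast
qed

lemma Mu_Hom':
  "set A \<subseteq> verts H \<Longrightarrow> set B \<subseteq> verts H \<Longrightarrow> Mu F A B \<in> Hom L.M (FObj F A @ FObj F B) (FObj F (A @ B))"
  using F.Mu_Hom[of A B] by auto

lemma Eps_inverses:
  obtains g where "L.inverses [] (FObj F []) (Eps F) g"
  using L.iso_inverses[OF F.Eps_iso F.Eps_Hom[simplified]] by blast

lemma FObj_append:
  assumes "set A \<subseteq> verts H" "set B \<subseteq> verts H"
  shows "length (FObj F (A @ B)) = length (FObj F A) + length (FObj F B)"
    and "set (FObj F (A @ B)) = set (FObj F A) \<union> set (FObj F B)"
proof -
  obtain g where "L.inverses (FObj F A @ FObj F B) (FObj F (A @ B)) (Mu F A B) g"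
    using Mu_inverses[OF assms] .
  from L.iso_length[OF this] L.iso_set[OF this]
  show "length (FObj F (A @ B)) = length (FObj F A) + length (FObj F B)"
    "set (FObj F (A @ B)) = set (FObj F A) \<union> set (FObj F B)" by auto
qed

lemma FObj_Nil [simp]: "FObj F [] = []"
proof -
  obtain g where "L.inverses [] (FObj F []) (Eps F) g" using Eps_inverses .
  from L.iso_length[OF this] show ?thesis by simp
qed

text \<open>The two lists are isomorphic but need not be equal. Length and underlying set survive,
  and together they decide whether a list has repetitions.\<close>

lemma FObj_concat:
  "set A \<subseteq> verts H \<Longrightarrow> length (FObj F A) = length (concat (map (var_image F) A)) \<and>
    set (FObj F A) = set (concat (map (var_image F) A))"
proof (induction A)
  case (Cons X A)
  then show ?case using FObj_append[of "[X]" A] by (simp add: var_image_def)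
qed simp

text \<open>Naturality of \<open>Mu\<close> relates \<open>\<phi> (s \<parallel> t)\<close> to a
  tensor product by isomorphisms, which have no live boxes. Masks split into two blocks only after
  pulling back along \<open>Mu\<close>.\<close>

lemma mask_\<phi>_Par:
  assumes "wf_diag H s" "wf_diag H t" "length m = length (FObj F (tgt s @ tgt t))"
  obtains b b' where "\<p> (Mu F (tgt s) (tgt t)) m = b @ b'"
    "length b = length (FObj F (tgt s))" "length b' = length (FObj F (tgt t))"
    "\<p> (Mu F (src H s) (src H t)) (\<p> (\<phi> (s \<parallel> t)) m) = \<p> (\<phi> s) b @ \<p> (\<phi> t) b'"
    "\<l> (\<phi> (s \<parallel> t)) m = \<l> (\<phi> s) b + \<l> (\<phi> t) b'"
proof -
  let ?\<mu> = "Mu F (tgt s) (tgt t)" and ?\<nu> = "Mu F (src H s) (src H t)"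
  have V: "set (src H s) \<subseteq> verts H" "set (src H t) \<subseteq> verts H" "set (tgt s) \<subseteq> verts H" "set (tgt t) \<subseteq> verts H"
    using wf_diag_verts[OF H.G] assms by auto
  obtain g where g: "L.inverses (FObj F (tgt s) @ FObj F (tgt t)) (FObj F (tgt s @ tgt t)) ?\<mu> g"
    using V Mu_inverses by blast
  obtain h where h: "L.inverses (FObj F (src H s) @ FObj F (src H t)) (FObj F (src H s @ src H t)) ?\<nu> h"
    using V Mu_inverses by blast
  have nat: "(\<phi> s \<otimes>\<^bsub>L.M\<^esub> \<phi> t) \<Zsemi>\<^bsub>L.M\<^esub> ?\<mu> = ?\<nu> \<Zsemi>\<^bsub>L.M\<^esub> \<phi> (s \<parallel> t)"
    using F.Mu_natural[of "cls H s" "src H s" "tgt s" "cls H t" "src H t" "tgt t"] assms by auto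
  have st: "\<phi> (s \<parallel> t) \<in> Hom L.M (FObj F (src H s @ src H t)) (FObj F (tgt s @ tgt t))"
    "\<phi> s \<in> Hom L.M (FObj F (src H s)) (FObj F (tgt s))" "\<phi> t \<in> Hom L.M (FObj F (src H t)) (FObj F (tgt t))"
    using assms by (auto intro!: \<phi>_Hom)
  then have ten: "\<phi> s \<otimes>\<^bsub>L.M\<^esub> \<phi> t \<in> Hom L.M (FObj F (src H s) @ FObj F (src H t)) (FObj F (tgt s) @ FObj F (tgt t))"
    using F.D.TenA_Hom by fastforce
  have "length (\<p> ?\<mu> m) = length (FObj F (tgt s)) + length (FObj F (tgt t))"
    using L.length_pull_arr[OF Mu_Hom'[OF V(3,4)] assms(3)] by simp
  then obtain b b' where b: "\<p> ?\<mu> m = b @ b'" "length b = length (FObj F (tgt s))" "length b' = length (FObj F (tgt t))"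
    by (rule length_eq_addE)
  note l = L.mask_Cmp[OF ten Mu_Hom'[OF V(3,4)] assms(3)]
  note r = L.mask_Cmp[OF Mu_Hom'[OF V(1,2)] st(1) assms(3)]
  note T = L.mask_TenA[OF st(2,3) b(2,3)]
  have "\<p> ?\<nu> (\<p> (\<phi> (s \<parallel> t)) m) = \<p> (\<phi> s) b @ \<p> (\<phi> t) b'"
    using l(1) r(1) T(1) b(1) nat by simp
  moreover have "\<l> (\<phi> (s \<parallel> t)) m = \<l> (\<phi> s) b + \<l> (\<phi> t) b'"
    using l(2) r(2) T(2) b(1) nat L.iso_mask(1)[OF g assms(3)]
      L.iso_mask(1)[OF h L.length_pull_arr[OF st(1) assms(3)]] by simp
  ultimately show ?thesis using b that by blast
qed

text \<open>
  The functor is not strict, so \<open>FObj F A\<close> need not be the concatenation of the images of the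
  variables in \<open>A\<close>. A mask on \<open>A\<close> is therefore transferred to \<open>FObj F A\<close> by pulling the full
  mask back along the image of the corresponding projection; no coherence theorem is needed.
\<close>

definition lift :: "'h list \<Rightarrow> bool list \<Rightarrow> bool list" where
  "lift A b = \<p> (\<phi> (proj A b)) (all_true (FObj F (keep A b)))"

lemma length_lift [simp]: "set A \<subseteq> verts H \<Longrightarrow> length (lift A b) = length (FObj F A)"
  unfolding lift_def by (rule L.length_pull_arr[OF \<phi>_Hom]) auto

lemma lift_all [simp]: "set A \<subseteq> verts H \<Longrightarrow> lift A (all_true A) = all_true (FObj F A)"
  by (simp add: lift_def \<phi>_cong[OF proj_all] \<phi>_Wires L.mask_cls FObj_verts)

lemma \<phi>_Discards:
  assumes "set A \<subseteq> verts H"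
  shows "\<phi> (Discards A) = cls L (Discards (FObj F A))"
proof -
  have "\<phi> (Discards A) \<in> Hom L.M (FObj F A) []" using assms by (intro \<phi>_Hom) auto
  then show ?thesis using F.D.Unt_terminal[of "\<phi> (Discards A)"] by simp
qed

lemma lift_none [simp]:
  "set A \<subseteq> verts H \<Longrightarrow> lift A (replicate (length A) False) = replicate (length (FObj F A)) False"
  by (simp add: lift_def \<phi>_cong[OF proj_none] \<phi>_Discards L.mask_cls FObj_verts)

text \<open>The projection of a concatenation is a parallel composite, so
  \<open>mask_\<phi>_Par\<close> applies; \<open>Mu\<close> keeps the full mask full, so each block
  again starts from a full mask.\<close>

lemma lift_append:
  assumes "length a = length A" "set A \<subseteq> verts H" "set B \<subseteq> verts H"
  shows "\<p> (Mu F A B) (lift (A @ B) (a @ b)) = lift A a @ lift B b"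
proof -
  let ?KA = "keep A a" and ?KB = "keep B b"
  have K: "set ?KA \<subseteq> verts H" "set ?KB \<subseteq> verts H" using assms set_keep by fastforce+
  have eq: "\<phi> (proj (A @ B) (a @ b)) = \<phi> (proj A a \<parallel> proj B b)"
    using assms by (intro \<phi>_cong proj_append)
  obtain g where g: "L.inverses (FObj F ?KA @ FObj F ?KB) (FObj F (?KA @ ?KB)) (Mu F ?KA ?KB) g"
    using Mu_inverses[OF K] .
  have w: "wf_diag H (proj A a)" "wf_diag H (proj B b)"
    "length (all_true (FObj F (?KA @ ?KB))) = length (FObj F (tgt (proj A a) @ tgt (proj B b)))"
    using assms by auto
  obtain c d where cd: "\<p> (Mu F ?KA ?KB) (all_true (FObj F (?KA @ ?KB))) = c @ d"
    "length c = length (FObj F ?KA)" "length d = length (FObj F ?KB)"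
    "\<p> (Mu F A B) (\<p> (\<phi> (proj A a \<parallel> proj B b)) (all_true (FObj F (?KA @ ?KB))))
      = \<p> (\<phi> (proj A a)) c @ \<p> (\<phi> (proj B b)) d"
    by (rule mask_\<phi>_Par[OF w]) (simp only: proj_simps)
  have "c @ d = all_true (FObj F ?KA) @ all_true (FObj F ?KB)"
    using cd(1) L.iso_all_true[OF g] by (simp add: replicate_add)
  then have "c = all_true (FObj F ?KA)" "d = all_true (FObj F ?KB)"
    using cd(2) by (auto simp: append_eq_append_conv)
  then show ?thesis using cd(4) eq assms(1) by (simp add: lift_def)
qed

text \<open>Pulling back along \<open>Mu\<close> both preserves and reflects the order of
  masks.\<close>

lemma lift_append_le_iff:
  assumes "length a = length A" "set A \<subseteq> verts H" "set B \<subseteq> verts H"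
    "length m = length (FObj F (A @ B))"
  shows "list_all2 (\<longrightarrow>) (lift (A @ B) (a @ b)) m \<longleftrightarrow>
     list_all2 (\<longrightarrow>) (lift A a @ lift B b) (\<p> (Mu F A B) m)" (is "?l \<longleftrightarrow> ?r")
proof
  obtain g where g: "L.inverses (FObj F A @ FObj F B) (FObj F (A @ B)) (Mu F A B) g"
    using Mu_inverses[OF assms(2,3)] .
  have len: "length (lift (A @ B) (a @ b)) = length (FObj F (A @ B))" using assms by simp
  show ?r if ?l
    using L.mask_arr_mono(1)[OF Mu_Hom'[OF assms(2,3)] len that] lift_append[OF assms(1-3)] by simp
  show ?l if ?r
    using L.iso_reflects[OF g len assms(4)] that lift_append[OF assms(1-3)] by simp
qed

lemma lift_Cons_pull:
  assumes "set (X # A) \<subseteq> verts H"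
  shows "\<p> (Mu F [X] A) (lift (X # A) (c # b)) = replicate (length (FObj F [X])) c @ lift A b"
proof -
  have "lift [X] [c] = replicate (length (FObj F [X])) c"
    using lift_all[of "[X]"] lift_none[of "[X]"] assms by (cases c) auto
  then show ?thesis using lift_append[of "[c]" "[X]" A b] assms by simp
qed

text \<open>Once \<open>Mu\<close> has split off the first variable, its block is a constant mask on
  both sides. Only monotonicity of the pullback along \<open>Mu\<close> enters, which gives the
  inequality that the lower bound needs at copies.\<close>

lemma lift_or:
  assumes "length b = length A" "length b' = length A" "set A \<subseteq> verts H"
  shows "list_all2 (\<longrightarrow>) (lift A (map2 (\<or>) b b')) (map2 (\<or>) (lift A b) (lift A b'))"
  using assms
proof (induction A arbitrary: b b')
  case Nil
  have "lift [] [] = []" using length_lift[of "[]"] by (simp del: length_lift)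
  with Nil show ?case by simp
next
  case (Cons X A)
  obtain c d c' d' where b: "b = c # d" "b' = c' # d'"
    using Cons.prems by (metis length_Suc_conv)
  have V: "set [X] \<subseteq> verts H" "set A \<subseteq> verts H" using Cons.prems by auto
  let ?n = "length (FObj F [X])" and ?\<mu> = "Mu F [X] A"
  let ?l = "lift (X # A) (c # d)" and ?l' = "lift (X # A) (c' # d')"
  have \<mu>: "?\<mu> \<in> Hom L.M (FObj F [X] @ FObj F A) (FObj F (X # A))" using Mu_Hom'[OF V] by simp
  have len: "length ?l = length (FObj F (X # A))" "length ?l' = length (FObj F (X # A))"
    using Cons.prems by auto
  have "list_all2 (\<longrightarrow>) (replicate ?n (c \<or> c') @ lift A (map2 (\<or>) d d'))
      (map2 (\<or>) (replicate ?n c @ lift A d) (replicate ?n c' @ lift A d'))"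
    using Cons.IH[of d d'] Cons.prems b
    by (auto simp: list_all2_conv_all_nth nth_append)
  also have "map2 (\<or>) (replicate ?n c @ lift A d) (replicate ?n c' @ lift A d') = map2 (\<or>) (\<p> ?\<mu> ?l) (\<p> ?\<mu> ?l')"
    using lift_Cons_pull Cons.prems(3) by simp
  finally have *: "list_all2 (\<longrightarrow>) (replicate ?n (c \<or> c') @ lift A (map2 (\<or>) d d')) (map2 (\<or>) (\<p> ?\<mu> ?l) (\<p> ?\<mu> ?l'))" .
  \<comment> \<open>Each of the two masks lies below their disjunction.\<close>
  have "list_all2 (\<longrightarrow>) (\<p> ?\<mu> ?l) (\<p> ?\<mu> (map2 (\<or>) ?l ?l'))" "list_all2 (\<longrightarrow>) (\<p> ?\<mu> ?l') (\<p> ?\<mu> (map2 (\<or>) ?l ?l'))"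
    using len by - (rule L.mask_arr_mono(1)[OF \<mu>]; auto simp: list_all2_conv_all_nth)+
  then have "list_all2 (\<longrightarrow>) (map2 (\<or>) (\<p> ?\<mu> ?l) (\<p> ?\<mu> ?l')) (\<p> ?\<mu> (map2 (\<or>) ?l ?l'))"
    by (auto simp: list_all2_conv_all_nth)
  with * have "list_all2 (\<longrightarrow>) (replicate ?n (c \<or> c') @ lift A (map2 (\<or>) d d')) (\<p> ?\<mu> (map2 (\<or>) ?l ?l'))"
    by (rule list_all2_trans[rotated]) blast
  moreover have "lift [X] [c \<or> c'] = replicate ?n (c \<or> c')"
    using lift_all[of "[X]"] lift_none[of "[X]"] V by (cases "c \<or> c'") auto
  ultimately show ?case
    using lift_append_le_iff[of "[c \<or> c']" "[X]" A "map2 (\<or>) ?l ?l'" "map2 (\<or>) d d'"] V len b by simp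
qed

text \<open>The counterpart of M(X) that is read off from the diagram, with multiplicities. For
  non-inputs X, the set M(X) always lies among its elements, and the two agree if \<pi>(c_X) is a
  normalised network.\<close>

definition mech :: "'h \<Rightarrow> 'l multiset" where
  "mech X = \<l> (\<phi> (Box X)) (all_true (FObj F [X]))"

text \<open>The functor preserves copying up to \<open>Mu\<close>, which has no live boxes, so marks
  are joined as by a copy of \<open>FObj F A\<close>.\<close>

lemma mask_\<phi>_Copies:
  assumes "set A \<subseteq> verts H" "length m = length (FObj F (A @ A))"
  obtains b b' where "\<p> (Mu F A A) m = b @ b'" "length b = length (FObj F A)" "length b' = length (FObj F A)"
    "\<p> (\<phi> (Copies A)) m = map2 (\<or>) b b'" "\<l> (\<phi> (Copies A)) m = {#}"
proof -
  have "length (\<p> (Mu F A A) m) = length (FObj F A) + length (FObj F A)"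
    using L.length_pull_arr[OF Mu_Hom'[OF assms(1,1)] assms(2)] by simp
  then obtain b b' where b: "\<p> (Mu F A A) m = b @ b'" "length b = length (FObj F A)" "length b' = length (FObj F A)"
    by (rule length_eq_addE)
  obtain g where g: "L.inverses (FObj F A @ FObj F A) (FObj F (A @ A)) (Mu F A A) g"
    using Mu_inverses[OF assms(1,1)] .
  have eq: "\<phi> (Copies A) = cls L (Copies (FObj F A)) \<Zsemi>\<^bsub>L.M\<^esub> Mu F A A"
    using F.FArr_Copy[of A] assms(1) by auto
  have c: "cls L (Copies (FObj F A)) \<in> Hom L.M (FObj F A) (FObj F A @ FObj F A)"
    using FObj_verts[OF assms(1)] by auto
  show ?thesis
    using that[OF b] L.mask_Cmp[OF c Mu_Hom'[OF assms(1,1)] assms(2)] L.iso_mask(1)[OF g assms(2)]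
      b FObj_verts[OF assms(1)] by (simp add: eq L.mask_cls)
qed

lemma mask_\<phi>_Swap:
  assumes "set A \<subseteq> verts H" "set B \<subseteq> verts H" "length m = length (FObj F (B @ A))"
  obtains b b' where "\<p> (Mu F B A) m = b @ b'" "length b = length (FObj F B)" "length b' = length (FObj F A)"
    "\<p> (Mu F A B) (\<p> (\<phi> (Swap A B)) m) = b' @ b" "\<l> (\<phi> (Swap A B)) m = {#}"
proof -
  have "length (\<p> (Mu F B A) m) = length (FObj F B) + length (FObj F A)"
    using L.length_pull_arr[OF Mu_Hom'[OF assms(2,1)] assms(3)] by simp
  then obtain b b' where b: "\<p> (Mu F B A) m = b @ b'" "length b = length (FObj F B)" "length b' = length (FObj F A)"
    by (rule length_eq_addE)
  obtain g where g: "L.inverses (FObj F B @ FObj F A) (FObj F (B @ A)) (Mu F B A) g"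
    using Mu_inverses[OF assms(2,1)] .
  have eq: "Mu F A B \<Zsemi>\<^bsub>L.M\<^esub> \<phi> (Swap A B) = cls L (Swap (FObj F A) (FObj F B)) \<Zsemi>\<^bsub>L.M\<^esub> Mu F B A"
    using F.Mu_Sym[of A B] assms by auto
  have s: "cls L (Swap (FObj F A) (FObj F B)) \<in> Hom L.M (FObj F A @ FObj F B) (FObj F B @ FObj F A)"
    "\<phi> (Swap A B) \<in> Hom L.M (FObj F (A @ B)) (FObj F (B @ A))"
    using FObj_verts assms by (auto intro!: \<phi>_Hom)
  show ?thesis
    using that[OF b] L.mask_Cmp[OF s(1) Mu_Hom'[OF assms(2,1)] assms(3)]
      L.mask_Cmp[OF Mu_Hom'[OF assms(1,2)] s(2) assms(3)]
      L.iso_mask(1)[OF g assms(3)] b FObj_verts assms by (simp add: eq L.mask_cls)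
qed

text \<open>Structural diagrams contribute nothing, and whatever mask arrives at a box is below the
  full one, so its contribution is bounded by \<open>mech\<close>.\<close>

lemma live_\<phi>_upper:
  "wf_diag H t \<Longrightarrow> length m = length (FObj F (tgt t)) \<Longrightarrow> \<l> (\<phi> t) m \<subseteq># (\<Sum>X\<in>#mset (boxes t). mech X)"
proof (induction t arbitrary: m)
  case (Wires A)
  then show ?case by (simp add: \<phi>_Wires L.mask_cls FObj_verts)
next
  case (Box X)
  have "\<phi> (Box X) \<in> Hom L.M (FObj F (parents H X)) (FObj F [X])" using Box by (intro \<phi>_Hom) auto
  then show ?case
    using Box L.mask_arr_mono(2)[OF _ _ list_all2_imp_below, of "\<phi> (Box X)" _ "FObj F [X]" m] by (simp add: mech_def)
next
  case (Copies A)
  have "\<l> (\<phi> (Copies A)) m = {#}" using Copies by (auto elim: mask_\<phi>_Copies)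
  then show ?case by simp
next
  case (Discards A)
  then show ?case by (simp add: \<phi>_Discards L.mask_cls FObj_verts)
next
  case (Swap A B)
  have "\<l> (\<phi> (Swap A B)) m = {#}" using Swap by (auto elim: mask_\<phi>_Swap)
  then show ?case by simp
next
  case (Seq s t)
  have st: "\<phi> s \<in> Hom L.M (FObj F (src H s)) (FObj F (tgt s))" "\<phi> t \<in> Hom L.M (FObj F (tgt s)) (FObj F (tgt t))"
    using Seq.prems by (auto intro!: \<phi>_Hom)
  then show ?case
    using Seq.IH(1)[of "\<p> (\<phi> t) m"] Seq.IH(2)[of m] Seq.prems
    by (simp add: \<phi>_Seq L.mask_Cmp[OF st] subset_mset.add_mono)
next
  case (Par s t)
  have w: "wf_diag H s" "wf_diag H t" "length m = length (FObj F (tgt s @ tgt t))"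
    using Par.prems by auto
  obtain b b' where "length b = length (FObj F (tgt s))" "length b' = length (FObj F (tgt t))"
    "\<l> (\<phi> (s \<parallel> t)) m = \<l> (\<phi> s) b + \<l> (\<phi> t) b'"
    by (rule mask_\<phi>_Par[OF w])
  then show ?case using Par.IH(1)[of b] Par.IH(2)[of b'] w by (simp add: subset_mset.add_mono)
qed

text \<open>
  With \<open>True\<close> in place of \<open>False\<close> this fails: \<open>\<phi> (Box X)\<close> may discard some of its inputs.
\<close>

lemma live_\<phi>_lower:
  assumes "wf_diag H t" "length b = length (tgt t)"
  shows "list_all2 (\<longrightarrow>) (lift (src H t) (pull False H t b)) (\<p> (\<phi> t) (lift (tgt t) b)) \<and>
    (\<Sum>X\<in>#live False H t b. mech X) \<subseteq># \<l> (\<phi> t) (lift (tgt t) b)"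
  using assms
proof (induction t arbitrary: b)
  case (Wires A)
  then show ?case by (simp add: \<phi>_Wires L.mask_cls FObj_verts list_all2_refl)
next
  case (Box X)
  then have V: "set [X] \<subseteq> verts H" "set (parents H X) \<subseteq> verts H" using wf_diag_verts[OF H.G, of "Box X"] by auto
  have "\<phi> (Box X) \<in> Hom L.M (FObj F (parents H X)) (FObj F [X])" using Box by (intro \<phi>_Hom) auto
  then have "length (\<p> (\<phi> (Box X)) (lift [X] b)) = length (FObj F (parents H X))"
    using V by simp
  moreover obtain c where "b = [c]" using Box.prems by (auto simp: length_Suc_conv)
  \<comment> \<open>\<open>pull False\<close> erases all marks at a box, so the inequality of masks
    starts from the empty mask; a marked output contributes exactly \<open>mech X\<close>.\<close>
  ultimately show ?case using V lift_all[of "[X]"]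
    by (cases c) (auto simp: mech_def list_all2_conv_all_nth)
next
  case (Copies A)
  then obtain c d where b: "b = c @ d" "length c = length A" "length d = length A"
    by (auto elim: length_eq_addE)
  have A: "set A \<subseteq> verts H" using Copies.prems by simp
  have len: "length (lift (A @ A) b) = length (FObj F (A @ A))" using A by simp
  obtain e f where e: "\<p> (Mu F A A) (lift (A @ A) b) = e @ f" "length e = length (FObj F A)"
    "length f = length (FObj F A)"
    "\<p> (\<phi> (Copies A)) (lift (A @ A) b) = map2 (\<or>) e f" "\<l> (\<phi> (Copies A)) (lift (A @ A) b) = {#}"
    using mask_\<phi>_Copies[OF A len] .
  have "e @ f = lift A c @ lift A d" using e(1) b lift_append[OF b(2) A A] by simp
  then have "e = lift A c" "f = lift A d" using e(2) A by (auto simp: append_eq_append_conv)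
  then show ?case using e b lift_or[OF b(2,3) A] by simp
next
  case (Discards A)
  have "length (\<p> (\<phi> (Discards A)) (lift [] b)) = length (FObj F A)"
    using Discards by (intro L.length_pull_arr[OF \<phi>_Hom]) auto
  then show ?case using Discards by (auto simp: list_all2_conv_all_nth)
next
  case (Swap A B)
  then have "length b = length B + length A" by simp
  then obtain c d where b: "b = c @ d" "length c = length B" "length d = length A"
    by (rule length_eq_addE)
  have A: "set A \<subseteq> verts H" "set B \<subseteq> verts H" using Swap.prems by auto
  have len: "length (lift (B @ A) b) = length (FObj F (B @ A))" using A by simp
  obtain e f where e: "\<p> (Mu F B A) (lift (B @ A) b) = e @ f" "length e = length (FObj F B)"
    "length f = length (FObj F A)"
    "\<p> (Mu F A B) (\<p> (\<phi> (Swap A B)) (lift (B @ A) b)) = f @ e" "\<l> (\<phi> (Swap A B)) (lift (B @ A) b) = {#}"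
    using mask_\<phi>_Swap[OF A len] .
  have "e @ f = lift B c @ lift A d" using e(1) b lift_append[OF b(2) A(2,1)] by simp
  then have "e = lift B c" "f = lift A d" using e(2) A by (auto simp: append_eq_append_conv)
  moreover have "length (\<p> (\<phi> (Swap A B)) (lift (B @ A) b)) = length (FObj F (A @ B))"
    using A len by (intro L.length_pull_arr[OF \<phi>_Hom]) auto
  ultimately show ?case
    using e b lift_append_le_iff[OF b(3) A] by (simp add: list_all2_refl)
next
  case (Seq s t)
  let ?c = "pull False H t b"
  have V: "set (tgt t) \<subseteq> verts H" "set (tgt s) \<subseteq> verts H" using wf_diag_verts[OF H.G] Seq.prems by auto
  have st: "\<phi> s \<in> Hom L.M (FObj F (src H s)) (FObj F (tgt s))" "\<phi> t \<in> Hom L.M (FObj F (tgt s)) (FObj F (tgt t))"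
    using Seq.prems by (auto intro!: \<phi>_Hom)
  have t: "list_all2 (\<longrightarrow>) (lift (tgt s) ?c) (\<p> (\<phi> t) (lift (tgt t) b))"
    "(\<Sum>X\<in>#live False H t b. mech X) \<subseteq># \<l> (\<phi> t) (lift (tgt t) b)"
    using Seq.IH(2)[of b] Seq.prems by auto
  have s: "list_all2 (\<longrightarrow>) (lift (src H s) (pull False H s ?c)) (\<p> (\<phi> s) (lift (tgt s) ?c))"
    "(\<Sum>X\<in>#live False H s ?c. mech X) \<subseteq># \<l> (\<phi> s) (lift (tgt s) ?c)"
    using Seq.IH(1)[of ?c] Seq.prems by auto
  \<comment> \<open>The mask that \<open>\<phi> t\<close> hands to \<open>\<phi> s\<close> may
    exceed the lifted one; monotonicity absorbs the excess.\<close>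
  note mono = L.mask_arr_mono[OF st(1) _ t(1)]
  have "list_all2 (\<longrightarrow>) (lift (src H s) (pull False H s ?c)) (\<p> (\<phi> s) (\<p> (\<phi> t) (lift (tgt t) b)))"
    using mono(1) V by (intro list_all2_trans[OF _ s(1), of "(\<longrightarrow>)"]) auto
  moreover have "(\<Sum>X\<in>#live False H s ?c. mech X) \<subseteq># \<l> (\<phi> s) (\<p> (\<phi> t) (lift (tgt t) b))"
    using mono(2) V by (intro subset_mset.order_trans[OF s(2)]) auto
  ultimately show ?case
    using Seq.prems V t(2) by (simp add: \<phi>_Seq L.mask_Cmp[OF st] subset_mset.add_mono)
next
  case (Par s t)
  then have "length b = length (tgt s) + length (tgt t)" by simp
  then obtain c d where b: "b = c @ d" "length c = length (tgt s)" "length d = length (tgt t)"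
    by (rule length_eq_addE)
  have V: "set (tgt t) \<subseteq> verts H" "set (tgt s) \<subseteq> verts H" "set (src H t) \<subseteq> verts H" "set (src H s) \<subseteq> verts H"
    using wf_diag_verts[OF H.G] Par.prems by auto
  let ?m = "lift (tgt s @ tgt t) b"
  have w: "wf_diag H s" "wf_diag H t" "length ?m = length (FObj F (tgt s @ tgt t))"
    using Par.prems V by auto
  obtain e f where e: "\<p> (Mu F (tgt s) (tgt t)) ?m = e @ f"
    "length e = length (FObj F (tgt s))" "length f = length (FObj F (tgt t))"
    "\<p> (Mu F (src H s) (src H t)) (\<p> (\<phi> (s \<parallel> t)) ?m) = \<p> (\<phi> s) e @ \<p> (\<phi> t) f"
    "\<l> (\<phi> (s \<parallel> t)) ?m = \<l> (\<phi> s) e + \<l> (\<phi> t) f"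
    by (rule mask_\<phi>_Par[OF w])
  have "e @ f = lift (tgt s) c @ lift (tgt t) d" using e(1) b lift_append[OF b(2) V(2,1)] by simp
  then have ef: "e = lift (tgt s) c" "f = lift (tgt t) d" using e(2) V by (auto simp: append_eq_append_conv)
  have s: "list_all2 (\<longrightarrow>) (lift (src H s) (pull False H s c)) (\<p> (\<phi> s) e)"
    "(\<Sum>X\<in>#live False H s c. mech X) \<subseteq># \<l> (\<phi> s) e"
    using Par.IH(1)[OF w(1) b(2)] ef by auto
  have t: "list_all2 (\<longrightarrow>) (lift (src H t) (pull False H t d)) (\<p> (\<phi> t) f)"
    "(\<Sum>X\<in>#live False H t d. mech X) \<subseteq># \<l> (\<phi> t) f"
    using Par.IH(2)[OF w(2) b(3)] ef by auto
  have "length (\<p> (\<phi> (s \<parallel> t)) ?m) = length (FObj F (src H s @ src H t))"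
    using w by (intro L.length_pull_arr[OF \<phi>_Hom]) auto
  moreover have "length (pull False H s c) = length (src H s)" using w b by simp
  ultimately show ?case
    using b e(4,5) s t lift_append_le_iff[of "pull False H s c" "src H s" "src H t"] V
    by (simp add: list_all2_appendI subset_mset.add_mono)
qed

end

text \<open>Used with \<open>e = False\<close> and the full mask: an output that is not an input
  must then come from a live box. This is how the assumption that all non-inputs of H are outputs
  takes effect.\<close>

lemma keep_subset_live:
  "wf_diag G t \<Longrightarrow> length b = length (tgt t) \<Longrightarrow>
    set (keep (tgt t) b) \<subseteq> set (keep (src G t) (pull e G t b)) \<union> set_mset (live e G t b)"
proof (induction t arbitrary: b)
  case (Box X)
  then show ?case by (cases b) auto
next
  case (Copies A)
  then obtain c d where b: "b = c @ d" "length c = length A" "length d = length A"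
    by (auto elim: length_eq_addE)
  have "length A = length c" "length c = length d" using b(2,3) by auto
  then have "set (keep A (map2 (\<or>) c d)) = set (keep A c) \<union> set (keep A d)"
    by (induction A c d rule: list_induct3) auto
  then show ?case using b by auto
next
  case (Swap A B)
  then have "length b = length B + length A" by simp
  then obtain c d where "b = c @ d" "length c = length B" "length d = length A"
    by (rule length_eq_addE)
  then show ?case by auto
next
  case (Seq s t)
  then have "set (keep (tgt s) (pull e G t b)) \<subseteq> set (keep (src G s) (pull e G s (pull e G t b))) \<union> set_mset (live e G s (pull e G t b))"
    "set (keep (tgt t) b) \<subseteq> set (keep (tgt s) (pull e G t b)) \<union> set_mset (live e G t b)"
    using Seq.IH(1)[of "pull e G t b"] Seq.IH(2)[of b] by simp_all
  then show ?case by auto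
next
  case (Par s t)
  then have "length b = length (tgt s) + length (tgt t)" by simp
  then obtain c d where b: "b = c @ d" "length c = length (tgt s)" "length d = length (tgt t)"
    by (rule length_eq_addE)
  then have "length (pull e G s c) = length (src G s)" using Par.prems by simp
  then show ?case using b Par.IH(1)[of c] Par.IH(2)[of d] Par.prems by auto
qed auto


section \<open>Normalised networks and directed paths\<close>

lemma length_flow [simp]:
  "wf_diag G t \<Longrightarrow> length ws = length (src G t) \<Longrightarrow> length (flow G t n ws) = length (tgt t)"
  by (induction t arbitrary: n ws) auto

text \<open>Used as follows: if all boxes of a composite are live, then so are all boxes of each
  factor.\<close>

lemma subset_mset_add_eqD:
  assumes "A + B = A' + B'" "A \<subseteq># A'" "B \<subseteq># B'"
  shows "A = A' \<and> B = B'"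
  using assms by (auto simp: subset_mset.le_iff_add)

text \<open>\<open>R\<close> is any set of wires that contains, with the output wire of a box, all
  wires entering that box; marks then never leave \<open>R\<close>. The multiset of live labels does
  not tell occurrences of a box apart, so the claim about boxes is made only when all of them are
  live.\<close>

lemma live_reaches:
  assumes "wf_diag G t" "length ws = length (src G t)"
    "list_all2 (\<lambda>c w. c \<longrightarrow> w \<in> R) b (flow G t n ws)"
    "\<forall>k < length (boxes t). n + k \<in> R \<longrightarrow> set (feeds G t n ws ! k) \<subseteq> R"
  shows "list_all2 (\<lambda>c w. c \<longrightarrow> w \<in> R) (pull e G t b) ws \<and>
    (live e G t b = mset (boxes t) \<longrightarrow> (\<forall>k < length (boxes t). n + k \<in> R))"
  using assms
proof (induction t arbitrary: b n ws)
  case (Box X)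
  then obtain c where "b = [c]" by (auto simp: list_all2_Cons2)
  then show ?case using Box by (auto simp: list_all2_conv_all_nth)
next
  case (Copies A)
  then obtain c d where b: "b = c @ d" "list_all2 (\<lambda>c w. c \<longrightarrow> w \<in> R) c ws"
    "list_all2 (\<lambda>c w. c \<longrightarrow> w \<in> R) d ws"
    by (auto simp: list_all2_append2)
  then show ?case using Copies.prems by (auto simp: list_all2_conv_all_nth)
next
  case (Discards A)
  then show ?case by (auto simp: list_all2_conv_all_nth)
next
  case (Swap A B)
  then obtain c d where b: "b = c @ d" "list_all2 (\<lambda>c w. c \<longrightarrow> w \<in> R) c (drop (length A) ws)"
    "list_all2 (\<lambda>c w. c \<longrightarrow> w \<in> R) d (take (length A) ws)"
    by (auto simp: list_all2_append2)
  moreover have "length c = length B" using b(2) Swap.prems by (auto dest!: list_all2_lengthD)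
  ultimately have "list_all2 (\<lambda>c w. c \<longrightarrow> w \<in> R) (d @ c) (take (length A) ws @ drop (length A) ws)"
    by (intro list_all2_appendI) auto
  then show ?case using b \<open>length c = length B\<close> by simp
next
  case (Seq s t)
  let ?w = "flow G s n ws" and ?n = "n + length (boxes s)"
  have "\<forall>k < length (boxes t). ?n + k \<in> R \<longrightarrow> set (feeds G t ?n ?w ! k) \<subseteq> R"
  proof (intro allI impI)
    fix k assume "k < length (boxes t)" "?n + k \<in> R"
    then show "set (feeds G t ?n ?w ! k) \<subseteq> R"
      using Seq.prems(4)[rule_format, of "length (boxes s) + k"] by (simp add: nth_append add.assoc)
  qed
  then have t: "list_all2 (\<lambda>c w. c \<longrightarrow> w \<in> R) (pull e G t b) ?w"
    "live e G t b = mset (boxes t) \<longrightarrow> (\<forall>k < length (boxes t). ?n + k \<in> R)"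
    using Seq.IH(2)[of ?w b ?n] Seq.prems by auto
  have "\<forall>k < length (boxes s). n + k \<in> R \<longrightarrow> set (feeds G s n ws ! k) \<subseteq> R"
  proof (intro allI impI)
    fix k assume "k < length (boxes s)" "n + k \<in> R"
    then show "set (feeds G s n ws ! k) \<subseteq> R"
      using Seq.prems(4)[rule_format, of k] by (simp add: nth_append)
  qed
  then have s: "list_all2 (\<lambda>c w. c \<longrightarrow> w \<in> R) (pull e G s (pull e G t b)) ws"
    "live e G s (pull e G t b) = mset (boxes s) \<longrightarrow> (\<forall>k < length (boxes s). n + k \<in> R)"
    using Seq.IH(1)[of ws "pull e G t b" n] Seq.prems t by auto
  have "n + k \<in> R" if "live e G (s ;; t) b = mset (boxes (s ;; t))" "k < length (boxes (s ;; t))" for k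
  proof -
    have "live e G s (pull e G t b) = mset (boxes s) \<and> live e G t b = mset (boxes t)"
      using that(1) by (intro subset_mset_add_eqD live_subset_boxes) simp
    then show ?thesis
      using s(2) t(2)[rule_format, of "k - length (boxes s)"] that(2) by (cases "k < length (boxes s)") auto
  qed
  then show ?case using s(1) by simp
next
  case (Par s t)
  let ?v = "take (length (src G s)) ws" and ?w = "drop (length (src G s)) ws" and ?n = "n + length (boxes s)"
  obtain c d where b: "b = c @ d" "list_all2 (\<lambda>c w. c \<longrightarrow> w \<in> R) c (flow G s n ?v)"
    "list_all2 (\<lambda>c w. c \<longrightarrow> w \<in> R) d (flow G t ?n ?w)"
    using Par.prems(3) by (auto simp: list_all2_append2)
  have c: "length c = length (tgt s)" using b(2) Par.prems by (auto dest!: list_all2_lengthD)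
  have "\<forall>k < length (boxes t). ?n + k \<in> R \<longrightarrow> set (feeds G t ?n ?w ! k) \<subseteq> R"
  proof (intro allI impI)
    fix k assume "k < length (boxes t)" "?n + k \<in> R"
    then show "set (feeds G t ?n ?w ! k) \<subseteq> R"
      using Par.prems(4)[rule_format, of "length (boxes s) + k"] by (simp add: nth_append add.assoc)
  qed
  then have t: "list_all2 (\<lambda>c w. c \<longrightarrow> w \<in> R) (pull e G t d) ?w"
    "live e G t d = mset (boxes t) \<longrightarrow> (\<forall>k < length (boxes t). ?n + k \<in> R)"
    using Par.IH(2)[of ?w d ?n] Par.prems b by auto
  have "\<forall>k < length (boxes s). n + k \<in> R \<longrightarrow> set (feeds G s n ?v ! k) \<subseteq> R"
  proof (intro allI impI)
    fix k assume "k < length (boxes s)" "n + k \<in> R"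
    then show "set (feeds G s n ?v ! k) \<subseteq> R"
      using Par.prems(4)[rule_format, of k] by (simp add: nth_append)
  qed
  then have s: "list_all2 (\<lambda>c w. c \<longrightarrow> w \<in> R) (pull e G s c) ?v"
    "live e G s c = mset (boxes s) \<longrightarrow> (\<forall>k < length (boxes s). n + k \<in> R)"
    using Par.IH(1)[of ?v c n] Par.prems b by auto
  have "n + k \<in> R" if "live e G (s \<parallel> t) b = mset (boxes (s \<parallel> t))" "k < length (boxes (s \<parallel> t))" for k
  proof -
    have "live e G s c = mset (boxes s) \<and> live e G t d = mset (boxes t)"
      using that(1) b c by (intro subset_mset_add_eqD live_subset_boxes) simp
    then show ?thesis
      using s(2) t(2)[rule_format, of "k - length (boxes s)"] that(2) by (cases "k < length (boxes s)") auto
  qed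
  moreover have "list_all2 (\<lambda>c w. c \<longrightarrow> w \<in> R) (pull e G s c @ pull e G t d) (?v @ ?w)"
    using s(1) t(1) by (rule list_all2_appendI)
  ultimately show ?case using b c by simp
qed auto

lemma normalised_if_live:
  assumes "wf_diag G t" "live e G t (all_true (tgt t)) = mset (boxes t)"
  shows "normalised G t"
proof -
  let ?n = "length (src G t)"
  \<comment> \<open>The wires with a path to an output; prepending a step shows that the set is
    closed backwards.\<close>
  let ?R = "{w. \<exists>v \<in> set (output_wires G t). (w, v) \<in> (wire_step G t)\<^sup>*}"
  have "\<forall>k < length (boxes t). ?n + k \<in> ?R"
  proof (rule live_reaches[THEN conjunct2, THEN mp])
    show "list_all2 (\<lambda>c w. c \<longrightarrow> w \<in> ?R) (all_true (tgt t)) (flow G t ?n [0..<?n])"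
      using assms(1) by (auto simp: list_all2_conv_all_nth output_wires_def intro!: nth_mem)
    show "\<forall>k < length (boxes t). ?n + k \<in> ?R \<longrightarrow> set (feeds G t ?n [0..<?n] ! k) \<subseteq> ?R"
    proof (intro allI impI subsetI)
      fix k w assume k: "k < length (boxes t)" "?n + k \<in> ?R" "w \<in> set (feeds G t ?n [0..<?n] ! k)"
      then have "(w, ?n + k) \<in> wire_step G t"
        by (auto simp: wire_step_def box_wire_def box_inputs_def)
      with k(2) show "w \<in> ?R" by (blast intro: converse_rtrancl_into_rtrancl)
    qed
  qed (use assms in auto)
  then show ?thesis by (auto simp: normalised_def box_wire_def)
qed

lemma wire_labels:
  assumes "wf_diag G t"
  shows "map ((!) (labels G t)) (output_wires G t) = tgt t"
    and "map (map ((!) (labels G t))) (box_inputs G t) = map (parents G) (boxes t)"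
proof -
  let ?l = "(!) (labels G t)" and ?n = "length (src G t)"
  have "map ?l [0..<?n] = src G t" "map ?l [?n..<?n + length (boxes t)] = boxes t"
    by (rule nth_equalityI; auto simp: labels_def nth_append)+
  from flow_feeds_labels[OF assms this]
  show "map ?l (output_wires G t) = tgt t" "map (map ?l) (box_inputs G t) = map (parents G) (boxes t)"
    by (simp_all add: output_wires_def box_inputs_def)
qed

lemma set_boxes: "wf_diag G t \<Longrightarrow> set (boxes t) \<subseteq> noninputs G"
  by (induction t) auto

text \<open>A step of wires is an edge of \<open>G\<close> between their labels, and every step ends
  at the wire of a box. Hence a path from a box stays among boxes, and in a network it avoids the
  labels of the inputs.\<close>

lemma normalised_dpath:
  assumes "wf_diag G t" "normalised G t" "X \<in> set (boxes t)"
  shows "\<exists>p. dpath G p \<and> hd p = X \<and> last p \<in> set (tgt t) \<and> set p \<subseteq> set (boxes t)"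
proof -
  let ?l = "(!) (labels G t)"
  have lb: "?l (box_wire G t k) = boxes t ! k" if "k < length (boxes t)" for k
    using that by (simp add: labels_def box_wire_def nth_append)
  have V: "set (boxes t) \<subseteq> verts G" using set_boxes[OF assms(1)] by (auto simp: noninputs_def)
  have path: "\<exists>p. dpath G p \<and> hd p = boxes t ! k \<and> last p = ?l v \<and> set p \<subseteq> set (boxes t)"
    if "(w, v) \<in> (wire_step G t)\<^sup>*" "w = box_wire G t k" "k < length (boxes t)" for w v k
    using that
  proof (induction arbitrary: k rule: converse_rtrancl_induct)
    case base
    then show ?case using lb[of k] V by (intro exI[of _ "[boxes t ! k]"]) (auto simp: dpath_def)
  next
    case (step w w')
    then obtain k' where k': "w' = box_wire G t k'" "k' < length (boxes t)" "w \<in> set (box_inputs G t ! k')"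
      by (auto simp: wire_step_def)
    have "map ?l (box_inputs G t ! k') = parents G (boxes t ! k')"
      using wire_labels(2)[OF assms(1)] k'(2) by (metis length_map nth_map)
    then have "boxes t ! k \<in> set (parents G (boxes t ! k'))"
      using k'(3) step.prems lb[of k] by (metis image_eqI list.set_map)
    then have e: "edge G (boxes t ! k) (boxes t ! k')"
      using k'(2) V by (auto simp: edge_def)
    obtain p where "dpath G p" "hd p = boxes t ! k'" "last p = ?l v" "set p \<subseteq> set (boxes t)"
      using step.IH k' by blast
    then show ?case using e step.prems V
      by (intro exI[of _ "boxes t ! k # p"]) (auto simp: dpath_def successively_Cons)
  qed
  obtain k where k: "k < length (boxes t)" "X = boxes t ! k" using assms(3) by (metis in_set_conv_nth)
  then obtain v where v: "v \<in> set (output_wires G t)" "(box_wire G t k, v) \<in> (wire_step G t)\<^sup>*"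
    using assms(2) by (auto simp: normalised_def)
  have "?l v \<in> set (tgt t)" using v(1) wire_labels(1)[OF assms(1)] by (metis image_eqI list.set_map)
  then show ?thesis using path[OF v(2) refl k(1)] k(2) by metis
qed

text \<open>Read from its end: the last vertex is an output but not an input, hence a box, and a
  parent of a box is again a box unless it is an input.\<close>

lemma dpath_hd_in_boxes:
  assumes "wf_diag G t" "dpath G p" "last p \<in> set (tgt t)" "set p \<inter> set (src G t) = {}"
  shows "hd p \<in> set (boxes t)"
  using assms(2-)
proof (induction p)
  case (Cons Z p)
  show ?case
  proof (cases "p = []")
    case True
    then show ?thesis using Cons.prems tgt_subset[OF assms(1)] by auto
  next
    case False
    then have "hd p \<in> set (boxes t)" "edge G Z (hd p)"
      using Cons by (auto simp: dpath_def successively_Cons)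
    then show ?thesis using Cons.prems parents_subset[OF assms(1)] by (fastforce simp: edge_def)
  qed
qed (simp add: dpath_def)


section \<open>Repetitions in lists and multiplicities in sums\<close>

lemma distinct_concat_map_iff:
  "distinct xs \<Longrightarrow> distinct (concat (map f xs)) \<longleftrightarrow>
    (\<forall>x \<in> set xs. distinct (f x)) \<and> (\<forall>x \<in> set xs. \<forall>y \<in> set xs. x \<noteq> y \<longrightarrow> set (f x) \<inter> set (f y) = {})"
  unfolding pairwise_def[symmetric]
proof (induction xs)
  case (Cons a xs)
  let ?d = "\<lambda>x y. set (f x) \<inter> set (f y) = {}"
  have "distinct (concat (map f (a # xs))) \<longleftrightarrow> distinct (f a) \<and> distinct (concat (map f xs)) \<and> (\<forall>y \<in> set xs. ?d a y)"
    by auto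
  moreover have "?d x a \<longleftrightarrow> ?d a x" for x by (simp add: Int_commute)
  moreover have "(\<forall>y. y \<in> set xs \<and> y \<noteq> a \<longrightarrow> ?d a y \<and> ?d a y) \<longleftrightarrow> (\<forall>y \<in> set xs. ?d a y)"
    using Cons.prems by auto
  ultimately show ?case using Cons unfolding list.set(2) pairwise_insert by (simp add: conj_ac)
qed simp

text \<open>Finiteness supplies a listing, and the right-hand side does not depend on which one is
  taken.\<close>

lemma image_into_iff:
  assumes "finite S"
  shows "image_into F S T \<longleftrightarrow> (\<forall>X \<in> S. distinct (var_image F X) \<and> set (var_image F X) \<subseteq> T) \<and>
    (\<forall>X \<in> S. \<forall>Y \<in> S. X \<noteq> Y \<longrightarrow> set (var_image F X) \<inter> set (var_image F Y) = {})" (is "_ \<longleftrightarrow> ?R")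
proof -
  have *: "distinct (concat (map (var_image F) xs)) \<and> set (concat (map (var_image F) xs)) \<subseteq> T \<longleftrightarrow> ?R"
    if "distinct xs" "set xs = S" for xs
    unfolding distinct_concat_map_iff[OF that(1)] that(2) set_concat set_map by blast
  obtain ys where ys: "distinct ys" "set ys = S" using finite_distinct_list[OF assms] by blast
  show ?thesis
  proof
    assume "image_into F S T"
    then obtain xs where xs: "distinct xs" "set xs = S"
      and "distinct (concat (map (var_image F) xs)) \<and> set (concat (map (var_image F) xs)) \<subseteq> T"
      unfolding image_into_def by blast
    from this(3) show ?R by (rule *[OF xs, THEN iffD1])
  next
    assume ?R
    then have "distinct (concat (map (var_image F) ys)) \<and> set (concat (map (var_image F) ys)) \<subseteq> T"
      by (rule *[OF ys, THEN iffD2])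
    then show "image_into F S T" using ys unfolding image_into_def by blast
  qed
qed

lemma image_onto_iff:
  assumes "finite S"
  shows "image_onto F S T \<longleftrightarrow> (\<forall>X \<in> S. distinct (var_image F X)) \<and> (\<Union>X\<in>S. set (var_image F X)) = T \<and>
    (\<forall>X \<in> S. \<forall>Y \<in> S. X \<noteq> Y \<longrightarrow> set (var_image F X) \<inter> set (var_image F Y) = {})" (is "_ \<longleftrightarrow> ?R")
proof -
  have *: "distinct (concat (map (var_image F) xs)) \<and> set (concat (map (var_image F) xs)) = T \<longleftrightarrow> ?R"
    if "distinct xs" "set xs = S" for xs
  proof -
    have "set (concat (map (var_image F) xs)) = (\<Union>X\<in>S. set (var_image F X))"
      using that(2) by simp
    then show ?thesis
      by (simp only: distinct_concat_map_iff[OF that(1)] that(2) conj_ac)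
  qed
  obtain ys where ys: "distinct ys" "set ys = S" using finite_distinct_list[OF assms] by blast
  show ?thesis
  proof
    assume "image_onto F S T"
    then obtain xs where xs: "distinct xs" "set xs = S"
      and "distinct (concat (map (var_image F) xs)) \<and> set (concat (map (var_image F) xs)) = T"
      unfolding image_onto_def by blast
    from this(3) show ?R by (rule *[OF xs, THEN iffD1])
  next
    assume ?R
    then have "distinct (concat (map (var_image F) ys)) \<and> set (concat (map (var_image F) ys)) = T"
      by (rule *[OF ys, THEN iffD2])
    then show "image_onto F S T" using ys unfolding image_onto_def by blast
  qed
qed

text \<open>Applied with \<open>c x\<close> the multiplicity of a fixed label in
  \<open>mech x\<close>: a sum of multisets has no repetitions if and only if no summand has any and
  different summands are disjoint.\<close>

lemma sum_le_1_iff: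
  fixes c :: "'a \<Rightarrow> nat"
  assumes "finite S"
  shows "sum c S \<le> 1 \<longleftrightarrow> (\<forall>x \<in> S. c x \<le> 1) \<and> (\<forall>x \<in> S. \<forall>y \<in> S. x \<noteq> y \<longrightarrow> c x = 0 \<or> c y = 0)"
  using assms unfolding pairwise_def[symmetric]
proof (induction S)
  case (insert a S)
  have z: "sum c S = 0 \<longleftrightarrow> (\<forall>y. y \<in> S \<and> y \<noteq> a \<longrightarrow> c y = 0)" using insert.hyps by auto
  have "sum c (insert a S) \<le> 1 \<longleftrightarrow> c a + sum c S \<le> 1" using insert.hyps by simp
  also have "\<dots> \<longleftrightarrow> c a \<le> 1 \<and> sum c S \<le> 1 \<and> (c a = 0 \<or> sum c S = 0)" by linarith
  finally show ?case unfolding insert.IH z pairwise_insert by auto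
qed simp

lemma distinct_iff_count: "distinct xs \<longleftrightarrow> (\<forall>x. count (mset xs) x \<le> 1)"
proof -
  have "count (mset xs) x = (if x \<in> set xs then 1 else 0) \<longleftrightarrow> count (mset xs) x \<le> 1" for x
  proof (cases "x \<in> set xs")
    case True
    then have "count (mset xs) x \<noteq> 0" by (metis count_mset_0_iff)
    then show ?thesis using True by (simp only: if_True) linarith
  next
    case False
    then have "count (mset xs) x = 0" by (metis count_mset_0_iff)
    then show ?thesis using False by (simp only: if_False zero_le simp_thms)
  qed
  then show ?thesis unfolding distinct_count_atmost_1 by simp
qed


section \<open>Structural well-behavedness and the network of the model\<close>

context dag_functor begin

lemma FObj_UN: "set A \<subseteq> verts H \<Longrightarrow> set (FObj F A) = (\<Union>X\<in>set A. set (var_image F X))"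
  using FObj_concat[of A] by simp

text \<open>The image of the list and the concatenation of the images agree in length and in
  underlying set, and a list is distinct exactly when its length is the cardinality of its
  set.\<close>

lemma distinct_FObj:
  assumes "set A \<subseteq> verts H" "distinct A"
    "\<And>X. X \<in> set A \<Longrightarrow> distinct (var_image F X)"
    "\<And>X Y. \<lbrakk>X \<in> set A; Y \<in> set A; X \<noteq> Y\<rbrakk> \<Longrightarrow> set (var_image F X) \<inter> set (var_image F Y) = {}"
  shows "distinct (FObj F A)"
proof -
  have "distinct (concat (map (var_image F) A))"
    using assms by (subst distinct_concat_map_iff) auto
  then show ?thesis
    using FObj_concat[OF assms(1)] by (metis card_distinct distinct_card)
qed

lemma Box_E:
  assumes "X \<in> noninputs H" "t \<in> \<phi> (Box X)"
  shows "wf_diag L t \<and> src L t = FObj F (parents H X) \<and> tgt t = var_image F X \<and> \<phi> (Box X) = cls L t"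
proof -
  have "\<phi> (Box X) \<in> Hom L.M (FObj F (parents H X)) (FObj F [X])"
    using assms(1) by (intro \<phi>_Hom) auto
  then obtain s where s: "\<phi> (Box X) = cls L s" "wf_diag L s" "src L s = FObj F (parents H X)" "tgt s = FObj F [X]"
    by (rule L.Hom_E)
  then have "diag_eq L s t" using assms(2) by (auto simp: cls_def)
  then show ?thesis using s diag_eq_types[OF L.G] cls_eqI by (metis var_image_def)
qed

lemma mech_subset:
  assumes "X \<in> noninputs H" "t \<in> \<phi> (Box X)"
  shows "mech X \<subseteq># mset (boxes t)"
  using Box_E[OF assms] live_subset_boxes[of True L t] by (simp add: mech_def L.mask_cls var_image_def)

text \<open>The candidate for the normalised network: all its boxes are live, hence connected to an
  output.\<close>

lemma mech_rep:
  assumes "X \<in> noninputs H"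
  obtains t where "t \<in> \<phi> (Box X)" "wf_diag L t" "src L t = FObj F (parents H X)" "tgt t = var_image F X"
    "mset (boxes t) = mech X" "normalised L t"
proof -
  have "\<phi> (Box X) \<in> Hom L.M (FObj F (parents H X)) (FObj F [X])"
    using assms by (intro \<phi>_Hom) auto
  then obtain t where t: "wf_diag L t" "src L t = FObj F (parents H X)" "tgt t = FObj F [X]"
    "\<phi> (Box X) = cls L t" "mset (boxes t) = \<l> (\<phi> (Box X)) (all_true (FObj F [X]))"
    by (rule L.live_rep)
  moreover have "t \<in> cls L t" using t(1) by (auto simp: cls_def intro: diag_eq.drefl)
  ultimately show ?thesis
    using that[of t] normalised_if_live[of L t True]
    by (auto simp: mech_def var_image_def L.mask_cls)
qed

lemma count_sum_mech: "count (\<Sum>X\<in>#mset_set S. mech X) Z = (\<Sum>X\<in>S. count (mech X) Z)"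
  by (metis count_sum sum_unfold_sum_mset)

end

section \<open>The two implications, for a fixed representative of the network of H\<close>

context
  fixes L :: "('l, 'o, 'a) causal_model" and H :: "('h, 'o, 'a) causal_model"
    and \<pi> :: "('h list, 'h diagram set, 'l list, 'l diagram set) monoidal_functor"
    and D :: "'h diagram set" and t :: "'h diagram"
  assumes func: "dag_functor H L \<pi>"
    and out: "noninputs H \<subseteq> outputs H" "outputs H \<subseteq> verts H"
    and D: "D = cls H t" "wf_diag H t"
    and t_src: "distinct (src H t)" "set (src H t) = inputs H"
    and t_tgt: "distinct (tgt t)" "set (tgt t) = outputs H"
    and t_boxes: "distinct (boxes t)" "set (boxes t) = noninputs H"
begin

interpretation dag_functor H L \<pi> by (rule func)

lemma fin: "finite (verts H)" "finite (inputs H)" "finite (outputs H)" "finite (noninputs H)"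
  and inV: "inputs H \<subseteq> verts H"
proof -
  show v: "finite (verts H)" and i: "inputs H \<subseteq> verts H" using H.G by (auto simp: is_open_dag_def)
  show "finite (inputs H)" "finite (outputs H)" "finite (noninputs H)"
    using v i out(2) by (auto simp: noninputs_def intro: finite_subset)
qed

lemma mset_boxes: "mset (boxes t) = mset_set (noninputs H)"
  using t_boxes by (metis mset_set_set)

lemma verts_split: "X \<in> verts H \<Longrightarrow> X \<in> inputs H \<or> X \<in> noninputs H"
  by (auto simp: noninputs_def)

lemma in_nin: "inputs L \<inter> noninputs L = {}" by (auto simp: noninputs_def)

lemma Pa: "X \<in> noninputs H \<Longrightarrow> set (parents H X) \<subseteq> verts H \<and> distinct (parents H X) \<and> X \<notin> set (parents H X)"
proof (intro conjI notI)
  assume X: "X \<in> noninputs H"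
  then have V: "X \<in> verts H" by (simp add: noninputs_def)
  then show "set (parents H X) \<subseteq> verts H" "distinct (parents H X)" using H.G by (auto simp: is_open_dag_def)
  assume "X \<in> set (parents H X)"
  then have "(X, X) \<in> {(Y, X). edge H Y X}" using V by (auto simp: edge_def)
  then show False using H.G by (auto simp: is_open_dag_def acyclic_def)
qed

text \<open>The witness is the representative of \<pi>(D_H) with live boxes only.
  \<open>live_\<phi>_upper\<close> bounds its boxes by the sum of the \<open>mech X\<close>,
  normalisation places each \<open>mech X\<close> inside M(X), and disjointness of the M(X) excludes
  repetitions.\<close>

lemma well_behaved_imp_network:
  assumes wb: "structurally_well_behaved H L \<pi>"
  shows "is_network L (FArr \<pi> D) \<and> image_into \<pi> (noninputs H) (noninputs L)"
proof
  let ?v = "\<lambda>X. set (var_image \<pi> X)"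
  let ?M = "mech_vars H L ?v"
  have nn: "is_normalised_network L (\<phi> (Box X))" if "X \<in> noninputs H" for X
    using wb that by (simp add: structurally_well_behaved_def)
  have dv: "distinct (var_image \<pi> X)" "?v X \<subseteq> verts L" if "X \<in> verts H" for X
    using wb that by (simp_all add: structurally_well_behaved_def)
  have dj: "?v X \<inter> ?v Y = {}" "?M X \<inter> ?M Y = {}" if "X \<in> verts H" "Y \<in> verts H" "X \<noteq> Y" for X Y
    using wb that by (simp_all add: structurally_well_behaved_def)
  have onto: "(\<Union>X\<in>inputs H. ?v X) = inputs L"
  proof -
    have "image_onto \<pi> (inputs H) (inputs L)" using wb by (simp add: structurally_well_behaved_def)
    then show ?thesis by (simp add: image_onto_iff[OF fin(2)])
  qed
  have nin: "noninputs H \<subseteq> verts H" "noninputs H \<inter> inputs H = {}" by (auto simp: noninputs_def)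
  show "image_into \<pi> (noninputs H) (noninputs L)"
  proof (subst image_into_iff[OF fin(4)], intro conjI ballI impI)
    fix X assume X: "X \<in> noninputs H"
    show "distinct (var_image \<pi> X)" using dv X nin by auto
    \<comment> \<open>The images of the inputs of H exhaust the inputs of L, so an image disjoint
      from them contains only non-inputs.\<close>
    have "?v X \<inter> ?v Y = {}" if "Y \<in> inputs H" for Y
      using dj(1)[of X Y] X that nin inV by auto
    then have "?v X \<inter> inputs L = {}" using onto by blast
    then show "?v X \<subseteq> noninputs L" using dv(2)[of X] X nin by (auto simp: noninputs_def)
    show "?v X \<inter> ?v Y = {}" if "Y \<in> noninputs H" "X \<noteq> Y" for Y
      using dj(1) X nin that by auto
  qed
  have mech: "count (mech X) Z \<le> 1" "set_mset (mech X) \<subseteq> ?M X" if X: "X \<in> noninputs H" for X Z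
  proof -
    obtain s where s: "s \<in> \<phi> (Box X)" "network L s" "normalised L s"
      using nn[OF X] by (auto simp: is_normalised_network_def)
    note E = Box_E[OF X s(1)]
    have d: "distinct (src L s @ boxes s)" using network_iff[OF L.G] E s(2) by blast
    have sub: "mech X \<subseteq># mset (boxes s)" using mech_subset[OF X s(1)] .
    have "count (mset (boxes s)) Z \<le> 1" using d distinct_iff_count[of "boxes s"] distinct_append by blast
    then show "count (mech X) Z \<le> 1" using sub by (meson mset_subset_eq_count order_trans)
    show "set_mset (mech X) \<subseteq> ?M X"
    proof
      fix Z assume "Z \<in># mech X"
      then have Z: "Z \<in> set (boxes s)" using sub by (metis mset_subset_eqD set_mset_mset)
      then obtain p where p: "dpath L p" "hd p = Z" "last p \<in> set (tgt s)" "set p \<subseteq> set (boxes s)"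
        using normalised_dpath[of L s Z] E s(3) by blast
      \<comment> \<open>The path runs through boxes, and in a network no box shares its label with
        an input, so the path avoids the images of the parents.\<close>
      have "set (src L s) = (\<Union>Y\<in>set (parents H X). ?v Y)" using E FObj_UN Pa[OF X] by simp
      then have "set p \<inter> (\<Union>Y\<in>set (parents H X). ?v Y) = {}" using p(4) d by auto
      moreover have "Z \<in> verts L" using Z E set_boxes[of L s] by (auto simp: noninputs_def)
      ultimately show "Z \<in> ?M X" using p E unfolding mech_vars_def by auto
    qed
  qed
  obtain u where u: "wf_diag L u" "src L u = FObj \<pi> (src H t)" "tgt u = FObj \<pi> (tgt t)" "\<phi> t = cls L u"
    "mset (boxes u) = \<l> (\<phi> t) (all_true (FObj \<pi> (tgt t)))"
    using L.live_rep[OF \<phi>_Hom[OF D(2) refl refl]] .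
  have "count (mset (boxes u)) Z \<le> 1" for Z
  proof -
    have "mset (boxes u) \<subseteq># (\<Sum>X\<in>#mset_set (noninputs H). mech X)"
      using live_\<phi>_upper[OF D(2), of "all_true (FObj \<pi> (tgt t))"] u(5) mset_boxes by simp
    then have "count (mset (boxes u)) Z \<le> (\<Sum>X\<in>noninputs H. count (mech X) Z)"
      using count_sum_mech mset_subset_eq_count by metis
    also have "\<dots> \<le> 1"
    proof (subst sum_le_1_iff[OF fin(4)], intro conjI ballI impI)
      fix X Y assume "X \<in> noninputs H" "Y \<in> noninputs H" "X \<noteq> Y"
      then have "set_mset (mech X) \<inter> set_mset (mech Y) = {}" using mech(2) dj(2) nin by blast
      then show "count (mech X) Z = 0 \<or> count (mech Y) Z = 0" by (meson disjoint_iff not_in_iff)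
    qed (rule mech(1))
    finally show ?thesis .
  qed
  then have "distinct (boxes u)" using distinct_iff_count by blast
  moreover have "distinct (FObj \<pi> A)" if "distinct A" "set A \<subseteq> verts H" for A
    using that dv(1) dj(1) by (intro distinct_FObj) blast+
  then have "distinct (FObj \<pi> (src H t))" "distinct (FObj \<pi> (tgt t))"
    using t_src t_tgt inV out(2) by blast+
  moreover have "set (src L u) \<inter> set (boxes u) = {}"
    using u(1,2) FObj_UN[of "src H t"] t_src inV onto set_boxes[of L u] in_nin by auto
  ultimately have "network L u" using network_iff[OF L.G u(1)] u(2,3) by simp
  moreover have "u \<in> cls L u" using u(1) by (auto simp: cls_def intro: diag_eq.drefl)
  ultimately show "is_network L (FArr \<pi> D)"
    unfolding is_network_def D(1) u(4) using u(1) by (auto simp: free_markov_def)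
qed

text \<open>The lower bound places the sum of the \<open>mech X\<close> among the boxes of the given
  network, where no label is repeated. So the \<open>mech X\<close> are disjoint and free of
  repetitions; the M(X) of non-inputs lie inside them, and the representatives from
  \<open>mech_rep\<close> are networks.\<close>

lemma network_imp_well_behaved:
  assumes net: "is_network L (FArr \<pi> D)" and onto: "image_onto \<pi> (inputs H) (inputs L)"
    and into: "image_into \<pi> (outputs H) (outputs L)" "image_into \<pi> (noninputs H) (noninputs L)"
  shows "structurally_well_behaved H L \<pi>"
proof -
  let ?v = "\<lambda>X. set (var_image \<pi> X)"
  let ?M = "mech_vars H L ?v"
  note in0 = onto[unfolded image_onto_iff[OF fin(2)]] and nin0 = into(2)[unfolded image_into_iff[OF fin(4)]]
  note I = in0[THEN conjunct1] in0[THEN conjunct2, THEN conjunct1] in0[THEN conjunct2, THEN conjunct2]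
  note N = nin0[THEN conjunct1] nin0[THEN conjunct2]
  have vI: "?v X \<subseteq> inputs L" if "X \<in> inputs H" for X using I(2) that by blast
  have vN: "?v X \<subseteq> noninputs L" if "X \<in> noninputs H" for X using N(1) that by simp
  have dv: "distinct (var_image \<pi> X)" if "X \<in> verts H" for X
    using I(1) N(1) verts_split[OF that] by metis
  have vV: "?v X \<subseteq> verts L" if "X \<in> verts H" for X
    using FObj_verts[of "[X]"] that by (simp add: var_image_def)
  have dj: "?v X \<inter> ?v Y = {}" if XY: "X \<in> verts H" "Y \<in> verts H" "X \<noteq> Y" for X Y
  proof -
    have io: "?v X \<inter> ?v Y = {}" if "X \<in> inputs H" "Y \<in> noninputs H" for X Y
      using vI[OF that(1)] vN[OF that(2)] in_nin by blast
    consider "X \<in> inputs H" "Y \<in> inputs H" | "X \<in> inputs H" "Y \<in> noninputs H"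
      | "Y \<in> inputs H" "X \<in> noninputs H" | "X \<in> noninputs H" "Y \<in> noninputs H"
      using verts_split[OF XY(1)] verts_split[OF XY(2)] by blast
    then show ?thesis
    proof cases
      case 1
      then show ?thesis using I(3) XY(3) by simp
    next
      case 2
      then show ?thesis by (rule io)
    next
      case 3
      then show ?thesis using io[of Y X] by (simp add: Int_commute)
    next
      case 4
      then show ?thesis using N(2) XY(3) by simp
    qed
  qed
  obtain u where u: "u \<in> FArr \<pi> D" "network L u" using net by (auto simp: is_network_def)
  have u_cls: "\<phi> t = cls L u" "wf_diag L u" "tgt u = FObj \<pi> (tgt t)"
  proof -
    obtain s where s: "\<phi> t = cls L s" "wf_diag L s" "tgt s = FObj \<pi> (tgt t)"
      using \<phi>_Hom[OF D(2) refl refl] by (rule L.Hom_E)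
    then have "diag_eq L s u" using u(1) D(1) by (auto simp: cls_def)
    then show "\<phi> t = cls L u" "wf_diag L u" "tgt u = FObj \<pi> (tgt t)"
      using s diag_eq_types[OF L.G] cls_eqI by metis+
  qed
  have V: "set (src H t) \<subseteq> verts H" "set (tgt t) \<subseteq> verts H" using wf_diag_verts[OF H.G D(2)] by auto
  \<comment> \<open>Marks stop at boxes here, so an output that is no input is the label of a live
    box; this applies to every non-input of H.\<close>
  have "set (tgt t) \<subseteq> set (src H t) \<union> set_mset (live False H t (all_true (tgt t)))"
    using keep_subset_live[OF D(2), of "all_true (tgt t)" False]
      set_keep[of "src H t" "pull False H t (all_true (tgt t))"] by auto
  then have "noninputs H \<subseteq> set_mset (live False H t (all_true (tgt t)))"
    using out(1) t_src t_tgt by (auto simp: noninputs_def)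
  then have "count (mset_set (noninputs H)) X \<le> count (live False H t (all_true (tgt t))) X" for X
    using fin(4) by (cases "X \<in> noninputs H") (auto simp: Suc_le_eq)
  then have "mset_set (noninputs H) \<subseteq># live False H t (all_true (tgt t))"
    by (rule mset_subset_eqI)
  then have "live False H t (all_true (tgt t)) = mset_set (noninputs H)"
    using live_subset_boxes[of False H t "all_true (tgt t)"] mset_boxes by (simp add: subset_mset.antisym)
  then have "(\<Sum>X\<in>#mset_set (noninputs H). mech X) \<subseteq># \<l> (\<phi> t) (all_true (FObj \<pi> (tgt t)))"
    using live_\<phi>_lower[OF D(2), of "all_true (tgt t)"] V by simp
  also have "\<dots> \<subseteq># mset (boxes u)"
    using live_subset_boxes[of True L u] u_cls by (simp add: L.mask_cls)
  finally have sum: "(\<Sum>X\<in>noninputs H. count (mech X) Z) \<le> count (mset (boxes u)) Z" for Z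
    unfolding count_sum_mech[symmetric] by (rule mset_subset_eq_count)
  have "distinct (boxes u)" using network_iff[OF L.G u_cls(2)] u(2) by simp
  then have "(\<Sum>X\<in>noninputs H. count (mech X) Z) \<le> 1" for Z
    using sum[of Z] distinct_iff_count[of "boxes u"] by (meson order_trans)
  note cnt = this[unfolded sum_le_1_iff[OF fin(4)]]
  have mech_dj: "set_mset (mech X) \<inter> set_mset (mech Y) = {}"
    if "X \<in> noninputs H" "Y \<in> noninputs H" "X \<noteq> Y" for X Y
  proof -
    have "count (mech X) Z = 0 \<or> count (mech Y) Z = 0" for Z using cnt[of Z, THEN conjunct2, rule_format, OF that] .
    then show ?thesis by (auto simp: count_eq_zero_iff)
  qed
  have src_mech: "set (FObj \<pi> (parents H X)) = (\<Union>Y\<in>set (parents H X). ?v Y)" if "X \<in> noninputs H" for X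
    using Pa[OF that] FObj_UN by blast
  have mech_nin: "set_mset (mech X) \<subseteq> noninputs L" if X: "X \<in> noninputs H" for X
  proof -
    obtain s where "wf_diag L s" "mset (boxes s) = mech X" using mech_rep[OF X] .
    then show ?thesis using set_boxes[of L s] set_mset_mset[of "boxes s"] by simp
  qed
  \<comment> \<open>An element of \<pi>(X) is an output of \<pi>(c_X) and, by disjointness from the
    images of the parents, not one of its inputs, so a box produces it.\<close>
  have v_mech: "?v X \<subseteq> set_mset (mech X)" if X: "X \<in> noninputs H" for X
  proof
    fix Z assume Z: "Z \<in> ?v X"
    obtain s where s: "wf_diag L s" "src L s = FObj \<pi> (parents H X)" "tgt s = var_image \<pi> X"
      "mset (boxes s) = mech X" using mech_rep[OF X] .
    have "Z \<notin> set (src L s)"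
    proof
      assume "Z \<in> set (src L s)"
      then obtain Y where Y: "Y \<in> set (parents H X)" "Z \<in> ?v Y" using s(2) src_mech[OF X] by auto
      then have "X \<in> verts H" "Y \<in> verts H" "X \<noteq> Y" using Pa[OF X] X by (auto simp: noninputs_def)
      then show False using dj[of X Y] Y(2) Z by blast
    qed
    then have "Z \<in> set (boxes s)" using Z s(3) tgt_subset[OF s(1)] by auto
    then show "Z \<in># mech X" using s(4) by (metis set_mset_mset)
  qed
  have Mvars: "?M X \<subseteq> set_mset (mech X)" if X: "X \<in> noninputs H" for X
  proof
    fix Z assume "Z \<in> ?M X"
    then obtain p where p: "dpath L p" "hd p = Z" "last p \<in> ?v X" "set p \<inter> (\<Union>Y\<in>set (parents H X). ?v Y) = {}"
      by (auto simp: mech_vars_def)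
    obtain s where s: "wf_diag L s" "src L s = FObj \<pi> (parents H X)" "tgt s = var_image \<pi> X"
      "mset (boxes s) = mech X" using mech_rep[OF X] .
    have "Z \<in> set (boxes s)"
      using dpath_hd_in_boxes[OF s(1) p(1)] p s src_mech[OF X] by simp
    then show "Z \<in># mech X" using s(4) by (metis set_mset_mset)
  qed
  \<comment> \<open>Inputs of L have no parents, so a directed path that ends in one has length
    0.\<close>
  have Mvars_in: "?M X \<subseteq> ?v X" if X: "X \<in> inputs H" for X
  proof
    fix Z assume "Z \<in> ?M X"
    then obtain p where p: "dpath L p" "hd p = Z" "last p \<in> ?v X" by (auto simp: mech_vars_def)
    obtain q z where q: "p = q @ [z]" using p(1) by (auto simp: dpath_def intro: rev_exhaust[of p])
    have "parents L z = []" using vI[OF X] p(3) q L.G by (auto simp: is_open_dag_def)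
    then have "\<not> edge L Y z" for Y by (simp add: edge_def)
    then have "q = []" using p(1) q by (auto simp: dpath_def successively_append_iff)
    then have "Z = last p" using p(2) q by simp
    then show "Z \<in> ?v X" using p(3) by simp
  qed
  have Mdj: "?M X \<inter> ?M Y = {}" if XY: "X \<in> verts H" "Y \<in> verts H" "X \<noteq> Y" for X Y
  proof -
    have a: "?M X \<inter> ?M Y = {}" if "X \<in> inputs H" "Y \<in> noninputs H" for X Y
      using Mvars_in[OF that(1)] vI[OF that(1)] Mvars[OF that(2)] mech_nin[OF that(2)] in_nin by blast
    consider "X \<in> inputs H" "Y \<in> inputs H" | "X \<in> inputs H" "Y \<in> noninputs H"
      | "X \<in> noninputs H" "Y \<in> inputs H" | "X \<in> noninputs H" "Y \<in> noninputs H"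
      using verts_split[OF XY(1)] verts_split[OF XY(2)] by blast
    then show ?thesis
    proof cases
      case 1
      then show ?thesis using Mvars_in dj[OF XY] by blast
    next
      case 4
      then show ?thesis using Mvars mech_dj XY(3) by blast
    qed (use a in blast)+
  qed
  have "is_normalised_network L (\<phi> (Box X))" if X: "X \<in> noninputs H" for X
  proof -
    obtain s where s: "s \<in> \<phi> (Box X)" "wf_diag L s" "src L s = FObj \<pi> (parents H X)" "tgt s = var_image \<pi> X"
      "mset (boxes s) = mech X" "normalised L s" using mech_rep[OF X] .
    have "\<phi> (Box X) = cls L s" using Box_E[OF X s(1)] by simp
    then have arr: "\<phi> (Box X) \<in> Arr (free_markov L)" using s(2) by (simp add: free_markov_def)
    have "distinct (boxes s)" using distinct_iff_count[of "boxes s"] s(5) cnt X by simp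
    moreover have "distinct (src L s)"
      unfolding s(3) using Pa[OF X] dv dj by (intro distinct_FObj) (auto simp: subset_iff)
    moreover have "set (src L s) \<inter> set (boxes s) = {}"
    proof -
      \<comment> \<open>The image of an input parent consists of inputs of L, which are not boxes;
        the image of any other parent lies in \<open>mech Y\<close>, which is disjoint from
        \<open>mech X\<close>.\<close>
      have "?v Y \<inter> set_mset (mech X) = {}" if Y: "Y \<in> set (parents H X)" for Y
      proof (cases "Y \<in> inputs H")
        case True
        then show ?thesis using vI mech_nin[OF X] in_nin by blast
      next
        case False
        then have "Y \<in> noninputs H" "X \<noteq> Y" using Y Pa[OF X] by (auto simp: noninputs_def)
        then show ?thesis using v_mech mech_dj[OF X] by blast
      qed
      moreover have "set (boxes s) = set_mset (mech X)" using s(5) by (metis set_mset_mset)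
      ultimately show ?thesis using s(3) src_mech[OF X] by auto
    qed
    moreover have "distinct (tgt s)" using s(4) dv X by (simp add: noninputs_def)
    ultimately have "network L s" using network_iff[OF L.G s(2)] by simp
    then show ?thesis using arr s by (auto simp: is_normalised_network_def)
  qed
  then show ?thesis
    using dv vV dj Mdj onto into unfolding structurally_well_behaved_def by blast
qed

end

theorem lemma52:
  fixes C :: "('o, 'a) markov_data"
    and L :: "('l, 'o, 'a) causal_model" and H :: "('h, 'o, 'a) causal_model"
    and \<pi> :: "('h list, 'h diagram set, 'l list, 'l diagram set) monoidal_functor"
    and D :: "'h diagram set"
  assumes "markov_category C" and "is_causal_model C L" and "is_causal_model C H"
    and "noninputs H \<subseteq> outputs H"
    and "cd_functor (free_markov H) (free_markov L) \<pi>"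
    and "model_network H D"
  shows "structurally_well_behaved H L \<pi> \<longleftrightarrow>
           is_network L (FArr \<pi> D) \<and>
           image_onto \<pi> (inputs H) (inputs L) \<and>
           image_into \<pi> (outputs H) (outputs L) \<and>
           image_into \<pi> (noninputs H) (noninputs L)"
proof -
  have G: "is_open_dag H" "is_open_dag L" "outputs H \<subseteq> verts H"
    using assms(2,3) by (auto simp: is_causal_model_def)
  then have func: "dag_functor H L \<pi>"
    using assms(5) by (simp add: dag_functor_def dag_def)
  obtain t where t: "t \<in> D" "network H t" "distinct (src H t)" "set (src H t) = inputs H"
    "distinct (tgt t)" "set (tgt t) = outputs H" "distinct (boxes t)"
    "set (boxes t) = {X \<in> noninputs H. \<exists>p. dpath H p \<and> hd p = X \<and> last p \<in> outputs H}"
    and arr: "D \<in> Arr (free_markov H)"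
    using assms(6) by (auto simp: model_network_def)
  \<comment> \<open>Each non-input is itself an output, so the path of length 0 shows that
    \<open>D\<close> has a box for every non-input.\<close>
  have "\<exists>p. dpath H p \<and> hd p = X \<and> last p \<in> outputs H" if "X \<in> noninputs H" for X
    using that assms(4) G(3) by (intro exI[of _ "[X]"]) (auto simp: dpath_def)
  then have boxes: "set (boxes t) = noninputs H" using t(8) by blast
  have wf: "wf_diag H t" using t(2) by (simp add: network_def)
  obtain s where s: "D = cls H s" using arr by (auto simp: free_markov_def)
  then have "diag_eq H s t" using t(1) by (simp add: cls_def)
  then have D: "D = cls H t" unfolding s by (rule cls_eqI)
  note ctx = func assms(4) G(3) D wf t(3-7) boxes
  show ?thesis
  proof
    assume wb: "structurally_well_behaved H L \<pi>"
    then have "image_onto \<pi> (inputs H) (inputs L)" "image_into \<pi> (outputs H) (outputs L)"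
      by (simp_all add: structurally_well_behaved_def)
    then show "is_network L (FArr \<pi> D) \<and> image_onto \<pi> (inputs H) (inputs L) \<and>
      image_into \<pi> (outputs H) (outputs L) \<and> image_into \<pi> (noninputs H) (noninputs L)"
      using well_behaved_imp_network[OF ctx wb] by simp
  qed (use network_imp_well_behaved[OF ctx] in simp)
qed

end
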